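(* Let $n\ge 1$ and let $f,g\in C_{-\infty}(\mathbb{R}^n)$ be integrable functions. Then $$\|f\star_{-\infty}g\|_1\le\frac{1}{2^n}\binom{2n}{n}\|f\star_{-\infty}\bar g\|_1 .$$ Equality holds if $f=\bar g$ and the superlevel sets $U_t(f)=\{x\in\mathbb{R}^n:f(x)\ge t\}$ are simplices for almost every $t\in(0,1)$.
   Context: $C_{-\infty}(\mathbb{R}^n)$ is the set of upper semicontinuous functions $f:\mathbb{R}^n\to[0,\infty)$ that are quasi-concave, i.e. $f(\lambda x+(1-\lambda)y)\ge\min\{f(x),f(y)\}$ for all $x,y\in\mathbb{R}^n$, $\lambda\in[0,1]$, and satisfy $\|f\|_\infty=f(0)=1$ and $\lim_{|x|\to\infty}f(x)=0$. The quasi-sum is $(f\star_{-\infty}g)(x)=\sup_{y+z=x}\min\{f(y),g(z)\}$. $\bar g(x)=g(-x)$. $\|f\|_1=\int_{\mathbb{R}^n}f(x)\,dx$ for $f\ge0$ (possibly $+\infty$). *)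

theory Defs
  imports "HOL-Analysis.Analysis"
begin

definition upper_semicontinuous :: "('a::topological_space \<Rightarrow> real) \<Rightarrow> bool" where
  "upper_semicontinuous f \<longleftrightarrow> (\<forall>x c. f x < c \<longrightarrow> (\<forall>\<^sub>F y in at x. f y < c))"

definition quasi_concave :: "('a::real_vector \<Rightarrow> real) \<Rightarrow> bool" where
  "quasi_concave f \<longleftrightarrow>
     (\<forall>x y. \<forall>u\<in>{0..1}. f (u *\<^sub>R x + (1 - u) *\<^sub>R y) \<ge> min (f x) (f y))"

(* The supremum norm is taken in the extended nonnegative reals because on the reals the
   supremum of an unbounded family is an unspecified value. *)
definition norm_sup :: "('a \<Rightarrow> real) \<Rightarrow> ennreal" where
  "norm_sup f = (SUP x. ennreal \<bar>f x\<bar>)"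

definition C_minus_infinity :: "('a::real_normed_vector \<Rightarrow> real) set" where
  "C_minus_infinity = {f. (\<forall>x. 0 \<le> f x) \<and> upper_semicontinuous f \<and> quasi_concave f \<and>
     norm_sup f = ennreal (f 0) \<and> f 0 = 1 \<and> (f \<longlongrightarrow> 0) at_infinity}"

(* A supremum in the reals, hence meaningful only if the family is bounded above;
   on C_minus_infinity all the minima lie in [0, 1]. *)
definition quasi_sum :: "('a::real_vector \<Rightarrow> real) \<Rightarrow> ('a \<Rightarrow> real) \<Rightarrow> 'a \<Rightarrow> real" where
  "quasi_sum f g x = (SUP (y, z)\<in>{(y, z). y + z = x}. min (f y) (g z))"

definition reflect :: "('a::uminus \<Rightarrow> real) \<Rightarrow> 'a \<Rightarrow> real" where
  "reflect g x = g (- x)"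

(* Only for nonnegative functions; the value may be infinite. *)
definition norm_L1 :: "('a::euclidean_space \<Rightarrow> real) \<Rightarrow> ennreal" where
  "norm_L1 f = (\<integral>\<^sup>+ x. ennreal (f x) \<partial>lborel)"

definition superlevel :: "('a \<Rightarrow> real) \<Rightarrow> real \<Rightarrow> 'a set" where
  "superlevel f t = {x. t \<le> f x}"

(* A simplex of any dimension, so degenerate (not full-dimensional) simplices are included. *)
definition is_simplex :: "'a::euclidean_space set \<Rightarrow> bool" where
  "is_simplex S \<longleftrightarrow> (\<exists>k. k simplex S)"

end

theory Submission
  imports Defs
begin

text \<open>
  Everything reduces to superlevel sets. For \<open>0 < t\<close> the superlevel set of the quasi-sum of \<open>f\<close> and
  \<open>g\<close> is the Minkowski sum \<open>K + L\<close> of the superlevel sets of \<open>f\<close> and \<open>g\<close>, which are compact and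
  convex (\<open>superlevel_quasi_sum\<close>), and reflecting \<open>g\<close> replaces \<open>L\<close> by \<open>- L\<close>. By the layer cake
  formula (\<open>norm_L1_quasi_sum\<close>) it therefore suffices to compare the volumes of \<open>K + L\<close> and \<open>K - L\<close>.

  Write \<open>M = K + L\<close>, \<open>N = K - L\<close>, and let \<open>n\<close> be the dimension. The two bodies have the same
  difference body: \<open>M - M = N - N\<close>, because both are the sum of \<open>K\<close>, \<open>L\<close>, \<open>- K\<close> and \<open>- L\<close>. The
  Brunn--Minkowski inequality bounds the volume of \<open>M - M\<close> from below by \<open>2 ^ n\<close> times that of \<open>M\<close>
  (\<open>brunn_minkowski_difference\<close>), and the Rogers--Shephard inequality bounds the volume of \<open>N - N\<close>
  from above by \<open>(2 n) choose n\<close> times that of \<open>N\<close> (\<open>rogers_shephard\<close>). The combination is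
  \<open>emeasure_sum_le_difference\<close>.

  If \<open>g\<close> is the reflection of \<open>f\<close>, the two bodies are \<open>K - K\<close> and \<open>K + K = 2 K\<close>, and equality says
  exactly that the Rogers--Shephard inequality is sharp for \<open>K\<close>, as it is for a simplex
  (\<open>rogers_shephard_simplex\<close>).

  Brunn--Minkowski is needed only for two sets of equal volume, where it involves no roots of
  volumes. The proof is that of Hadwiger and Ohmann: for single boxes it is the inequality of the
  arithmetic and geometric mean, finite families of boxes are reduced to smaller ones by cutting
  both families with parallel hyperplanes in the same ratio of volumes, and open sets are
  exhausted by finite families of boxes.

  Rogers--Shephard is obtained by integrating the covariogram, the volume of
  \<open>K \<inter> (x + K)\<close> as a function of \<open>x\<close>. Its integral is the square of the volume \<open>V\<close> of \<open>K\<close>. If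
  \<open>x = l (a - b)\<close> with \<open>a\<close>, \<open>b\<close> in \<open>K\<close>, the intersection contains \<open>l a + (1 - l) K\<close>, so that the
  covariogram is at least \<open>V (1 - p x) ^ n\<close>, with \<open>p\<close> the gauge of \<open>K - K\<close>; the integral of
  \<open>(1 - p x) ^ n\<close> over \<open>K - K\<close> is the volume of \<open>K - K\<close> divided by \<open>(2 n) choose n\<close>. If \<open>K\<close> is a
  simplex, the intersection with a translate is a homothetic copy of \<open>K\<close>, and all these
  inequalities are equalities.
\<close>

section \<open>Minkowski sums and affine images\<close>

lemma emeasure_affine_image:
  fixes S :: "'a::euclidean_space set"
  assumes "S \<in> sets borel"
  shows "emeasure lborel ((\<lambda>x. a + c *\<^sub>R x) ` S) = ennreal (\<bar>c\<bar> ^ DIM('a)) * emeasure lborel S"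
proof -
  have b: "(\<lambda>x. a + c *\<^sub>R x) ` S \<in> sets borel"
  proof (cases "c = 0")
    case True
    have "(\<lambda>x. a + c *\<^sub>R x) ` S \<subseteq> {a}" using True by auto
    then have "finite ((\<lambda>x. a + c *\<^sub>R x) ` S)" using finite_subset by blast
    then show ?thesis by (simp add: finite_imp_closed)
  next
    case False
    have "(\<lambda>x. a + c *\<^sub>R x) ` S = (\<lambda>y. (y - a) /\<^sub>R c) -` S \<inter> space borel"
      using False by (force simp: image_iff)
    also have "\<dots> \<in> sets borel" using assms by (intro measurable_sets[of _ borel]) auto
    finally show ?thesis .
  qed
  have "(\<lambda>x. c *\<^sub>R x + a) ` S = (\<lambda>x. a + c *\<^sub>R x) ` S" by (simp add: add.commute)
  then show ?thesis
    using emeasure_lebesgue_affine[of c a S] assms b by simp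
qed

lemma fmeasurable_bounded_open:
  fixes S :: "'a::euclidean_space set"
  assumes "open S" "bounded S" shows "S \<in> fmeasurable lborel"
  using assms emeasure_bounded_finite by (auto simp: fmeasurable_def)

lemma open_set_plus:
  fixes A B :: "'a::euclidean_space set"
  assumes "open A" shows "open (A + B)"
proof -
  have "A + B = (\<Union>b\<in>B. (\<lambda>a. b + a) ` A)" by (force simp: set_plus_def add.commute)
  then show ?thesis using assms open_translation by (auto intro!: open_UN)
qed

lemma bounded_set_plus:
  fixes A B :: "'a::euclidean_space set"
  assumes "bounded A" "bounded B" shows "bounded (A + B)"
  using bounded_plus[OF assms] by (simp add: set_plus_image case_prod_unfold image_def)

lemma uminus_image_plus:
  fixes A B :: "'a::ab_group_add set"
  shows "uminus ` (A + B) = uminus ` A + uminus ` B"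
proof (intro set_eqI iffI)
  fix x assume "x \<in> uminus ` (A + B)"
  then obtain a b where "a \<in> A" "b \<in> B" "x = - (a + b)" by (blast elim: set_plus_elim)
  then have "x = - a + - b" by simp
  then show "x \<in> uminus ` A + uminus ` B" using \<open>a \<in> A\<close> \<open>b \<in> B\<close> by (simp only: set_plus_intro imageI)
next
  fix x assume "x \<in> uminus ` A + uminus ` B"
  then obtain a b where "a \<in> A" "b \<in> B" "x = - a + - b" by (blast elim: set_plus_elim)
  then have "x = - (a + b)" by simp
  then show "x \<in> uminus ` (A + B)" using \<open>a \<in> A\<close> \<open>b \<in> B\<close> by (simp only: set_plus_intro imageI)
qed

lemma compact_set_plus:
  fixes A B :: "'a::euclidean_space set"
  assumes "compact A" "compact B" shows "compact (A + B)"
proof -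
  have "A + B = {x + y | x y. x \<in> A \<and> y \<in> B}" by (auto simp: set_plus_def)
  then show ?thesis using compact_sums[OF assms] by simp
qed

lemma measure_uminus_image:
  fixes S :: "'a::euclidean_space set"
  assumes "S \<in> sets borel"
  shows "measure lborel (uminus ` S) = measure lborel S"
  using emeasure_affine_image[OF assms, of 0 "-1"] by (simp add: measure_def)

lemma fmeasurable_compact:
  fixes S :: "'a::euclidean_space set"
  assumes "compact S" shows "S \<in> fmeasurable lborel"
  using assms emeasure_compact_finite by (auto simp: fmeasurable_def compact_imp_closed)

text \<open>By convexity, \<open>K + K\<close> is nothing but \<open>2 K\<close>.\<close>
lemma emeasure_convex_double:
  fixes K :: "'a::euclidean_space set"
  assumes "compact K" "convex K"
  shows "emeasure lborel (K + K) = ennreal (2 ^ DIM('a)) * emeasure lborel K"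
proof -
  have "K + K = (\<lambda>x. 0 + 2 *\<^sub>R x) ` K"
  proof (intro set_eqI iffI)
    fix x assume "x \<in> K + K"
    then obtain a b where ab: "x = a + b" "a \<in> K" "b \<in> K" by (rule set_plus_elim)
    then have "(1/2) *\<^sub>R a + (1/2) *\<^sub>R b \<in> K" using assms(2) by (intro convexD) auto
    moreover have "x = 0 + 2 *\<^sub>R ((1/2) *\<^sub>R a + (1/2) *\<^sub>R b)" using ab by (simp add: scaleR_right_distrib)
    ultimately show "x \<in> (\<lambda>x. 0 + 2 *\<^sub>R x) ` K" by blast
  next
    fix x assume "x \<in> (\<lambda>x. 0 + 2 *\<^sub>R x) ` K"
    then obtain k where "k \<in> K" "x = 0 + 2 *\<^sub>R k" by blast
    then show "x \<in> K + K" by (simp add: scaleR_2 set_plus_intro)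
  qed
  then show ?thesis using emeasure_affine_image[of K 0 2] assms(1) by (simp add: borel_compact)
qed

section \<open>The Brunn--Minkowski inequality for a convex body and its reflection\<close>

lemma box_Int_below:
  fixes a b :: "'a::euclidean_space"
  assumes "i \<in> Basis"
  shows "box a b \<inter> {x. x \<bullet> i < c} = box a (b + (min (b \<bullet> i) c - b \<bullet> i) *\<^sub>R i)"
  using assms
  by (auto simp: box_def algebra_simps inner_Basis if_distrib cong: if_cong)

lemma box_Int_above:
  fixes a b :: "'a::euclidean_space"
  assumes "i \<in> Basis"
  shows "box a b \<inter> {x. c < x \<bullet> i} = box (a + (max (a \<bullet> i) c - a \<bullet> i) *\<^sub>R i) b"
  using assms
  by (auto simp: box_def algebra_simps inner_Basis if_distrib cong: if_cong)

text \<open>Open boxes have the advantage that cutting along a coordinate hyperplane produces open boxes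
  again, at the cost of the null set where the hyperplane is.\<close>
definition box_family :: "'a::euclidean_space set set \<Rightarrow> bool" where
  "box_family \<A> \<longleftrightarrow> finite \<A> \<and> disjoint \<A> \<and> (\<forall>A\<in>\<A>. A \<noteq> {} \<and> (\<exists>a b. A = box a b))"

lemma box_family_open: "box_family \<A> \<Longrightarrow> open (\<Union>\<A>)"
  unfolding box_family_def by (metis open_Union open_box)

lemma box_family_bounded: "box_family \<A> \<Longrightarrow> bounded (\<Union>\<A>)"
  unfolding box_family_def by (metis bounded_Union bounded_box)

definition family_restrict :: "'a set set \<Rightarrow> 'a set \<Rightarrow> 'a set set" where
  "family_restrict \<A> H = (\<lambda>A. A \<inter> H) ` \<A> - {{}}"

lemma Union_family_restrict: "\<Union>(family_restrict \<A> H) = \<Union>\<A> \<inter> H"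
  unfolding family_restrict_def by auto

lemma card_family_restrict_le: "finite \<A> \<Longrightarrow> card (family_restrict \<A> H) \<le> card \<A>"
  unfolding family_restrict_def
  by (metis Diff_subset card_image_le card_mono finite_imageI le_trans)

lemma card_family_restrict_less:
  assumes "finite \<A>" "A \<in> \<A>" "A \<inter> H = {}"
  shows "card (family_restrict \<A> H) < card \<A>"
proof -
  have "family_restrict \<A> H \<subseteq> (\<lambda>A. A \<inter> H) ` (\<A> - {A})"
    using assms unfolding family_restrict_def by auto
  then have "card (family_restrict \<A> H) \<le> card (\<A> - {A})"
    by (meson assms(1) card_image_le card_mono finite_Diff finite_imageI le_trans)
  also have "\<dots> < card \<A>" using assms by (meson card_Diff1_less)
  finally show ?thesis .
qed

lemma box_family_restrict:
  assumes "box_family \<A>" and "\<And>a b. \<exists>a' b'. box a b \<inter> H = box a' b'"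
  shows "box_family (family_restrict \<A> H)"
proof -
  have "disjoint (family_restrict \<A> H)"
    using assms(1) unfolding box_family_def family_restrict_def pairwise_def disjnt_def by blast
  then show ?thesis
    using assms unfolding box_family_def family_restrict_def by auto
qed

lemma hyperplane_null: "i \<in> Basis \<Longrightarrow> {x::'a::euclidean_space. x \<bullet> i = c} \<in> null_sets lborel"
proof -
  assume "i \<in> Basis"
  then have "negligible {x. x \<bullet> i = c}" by (rule negligible_standard_hyperplane)
  moreover have "{x. x \<bullet> i = c} \<in> sets borel" by measurable
  ultimately show ?thesis
    by (simp add: negligible_iff_null_sets null_sets_completion_iff)
qed

lemma measure_split_hyperplane:
  fixes A :: "'a::euclidean_space set"
  assumes "i \<in> Basis" "A \<in> fmeasurable lborel"
  shows "measure lborel A = measure lborel (A \<inter> {x. x \<bullet> i < c}) + measure lborel (A \<inter> {x. c < x \<bullet> i})"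
proof -
  have A: "A \<in> sets borel" using assms by auto
  have "measure lborel A = measure lborel (A - {x. x \<bullet> i = c})"
    using A hyperplane_null[OF assms(1), of c] by (simp add: measure_Diff_null_set)
  also have "A - {x. x \<bullet> i = c} = (A \<inter> {x. x \<bullet> i < c}) \<union> (A \<inter> {x. c < x \<bullet> i})" by auto
  also have "measure lborel \<dots> = measure lborel (A \<inter> {x. x \<bullet> i < c}) + measure lborel (A \<inter> {x. c < x \<bullet> i})"
    by (rule measure_Un2[THEN trans])
       (use assms(2) in \<open>auto intro!: fmeasurable_Int_fmeasurable arg_cong[where f = "measure lborel"]\<close>)
  finally show ?thesis .
qed

text \<open>The sum of two boxes is the box with the added side lengths, and
  \<open>4 p q \<le> (p + q) ^ 2\<close> for every pair of sides. Multiplying over the coordinates compares the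
  squares of the volumes.\<close>
lemma brunn_minkowski_boxes:
  fixes a b c d :: "'a::euclidean_space"
  assumes ne: "box a b \<noteq> {}" "box c d \<noteq> {}"
    and eq: "measure lborel (box a b) = measure lborel (box c d)"
  shows "2 ^ DIM('a) * measure lborel (box a b) \<le> measure lborel (box a b + box c d)"
proof -
  have ab: "\<And>i. i \<in> Basis \<Longrightarrow> a \<bullet> i < b \<bullet> i" and cd: "\<And>i. i \<in> Basis \<Longrightarrow> c \<bullet> i < d \<bullet> i"
    using ne by (auto simp: box_ne_empty)
  define V where "V = measure lborel (box a b)"
  have V: "V = (\<Prod>i\<in>Basis. (b - a) \<bullet> i)" "V = (\<Prod>i\<in>Basis. (d - c) \<bullet> i)"
    unfolding V_def using eq ab cd by (auto simp: measure_lborel_box_eq less_imp_le)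
  have W: "measure lborel (box (a + c) (b + d)) = (\<Prod>i\<in>Basis. (b + d - (a + c)) \<bullet> i)"
    using ab cd by (force simp: measure_lborel_box_eq inner_simps intro!: add_mono less_imp_le)
  have "(2 ^ DIM('a) * V)\<^sup>2 = (\<Prod>i\<in>(Basis::'a set). 4 * (((b - a) \<bullet> i) * ((d - c) \<bullet> i)))"
  proof -
    have "(\<Prod>i\<in>(Basis::'a set). 4 * (((b - a) \<bullet> i) * ((d - c) \<bullet> i))) = 4 ^ DIM('a) * (V * V)"
      unfolding prod.distrib by (simp add: V[symmetric])
    then show ?thesis by (simp add: power2_eq_square power_mult_distrib[symmetric])
  qed
  also have "\<dots> \<le> (\<Prod>i\<in>Basis. ((b + d - (a + c)) \<bullet> i)\<^sup>2)"
  proof (rule prod_mono, intro conjI)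
    fix i :: 'a assume i: "i \<in> Basis"
    show "0 \<le> 4 * (((b - a) \<bullet> i) * ((d - c) \<bullet> i))"
      using ab[OF i] cd[OF i] by (auto simp: inner_simps)
    have "0 \<le> ((b - a) \<bullet> i - (d - c) \<bullet> i)\<^sup>2" by simp
    then show "4 * (((b - a) \<bullet> i) * ((d - c) \<bullet> i)) \<le> ((b + d - (a + c)) \<bullet> i)\<^sup>2"
      by (simp add: power2_eq_square algebra_simps)
  qed
  also have "\<dots> = (measure lborel (box (a + c) (b + d)))\<^sup>2"
    by (simp add: W prod_power_distrib)
  finally have "2 ^ DIM('a) * V \<le> measure lborel (box (a + c) (b + d))"
    by (rule power2_le_imp_le) simp
  also have "\<dots> \<le> measure lborel (box a b + box c d)"
  proof (rule measure_mono_fmeasurable)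
    show "box (a + c) (b + d) \<subseteq> box a b + box c d"
    proof
      fix x assume x: "x \<in> box (a + c) (b + d)"
      \<comment> \<open>Divide each coordinate of x in the ratio of the sides of the two boxes.\<close>
      define r where "r i = (b \<bullet> i - a \<bullet> i) / ((b \<bullet> i - a \<bullet> i) + (d \<bullet> i - c \<bullet> i))" for i
      define y where "y = (\<Sum>i\<in>Basis. (a \<bullet> i + r i * (x \<bullet> i - a \<bullet> i - c \<bullet> i)) *\<^sub>R i)"
      have yi: "y \<bullet> i = a \<bullet> i + r i * (x \<bullet> i - a \<bullet> i - c \<bullet> i)" if "i \<in> Basis" for i
        using that by (simp add: y_def)
      have "y \<in> box a b \<and> x - y \<in> box c d"
        unfolding box_def mem_Collect_eq
      proof (intro conjI ballI)
        fix i :: 'a assume i: "i \<in> Basis"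
        define p q t where "p = b \<bullet> i - a \<bullet> i" and "q = d \<bullet> i - c \<bullet> i" and "t = x \<bullet> i - a \<bullet> i - c \<bullet> i"
        have pq: "0 < p" "0 < q" "0 < t" "t < p + q"
          using ab[OF i] cd[OF i] x i by (auto simp: p_def q_def t_def box_def inner_simps algebra_simps)
        have y: "y \<bullet> i = a \<bullet> i + p / (p + q) * t"
          using yi[OF i] by (simp add: r_def p_def q_def t_def)
        have "p * t < p * (p + q)" "q * t < q * (p + q)" using pq by auto
        then have 1: "p / (p + q) * t < p" "q / (p + q) * t < q"
          using pq by (auto simp: field_simps)
        have 2: "0 < p / (p + q) * t" "0 < q / (p + q) * t" using pq by auto
        have 3: "t = p / (p + q) * t + q / (p + q) * t"
          using pq by (simp add: add_divide_distrib[symmetric] distrib_right[symmetric])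
        show "a \<bullet> i < y \<bullet> i" "y \<bullet> i < b \<bullet> i" using 1 2 y by (auto simp: p_def)
        show "c \<bullet> i < (x - y) \<bullet> i" "(x - y) \<bullet> i < d \<bullet> i"
          using 1 2 3 y by (auto simp: q_def t_def inner_simps)
      qed
      then show "x \<in> box a b + box c d" by (metis add.commute diff_add_cancel set_plus_intro)
    qed
    show "box a b + box c d \<in> fmeasurable lborel"
      by (intro fmeasurable_bounded_open open_set_plus bounded_set_plus) auto
  qed auto
  finally show ?thesis by (simp add: V_def)
qed

text \<open>The volume below a moving hyperplane is a continuous function of the position of the
  hyperplane, since this holds for each box by the product formula, so the intermediate value
  theorem applies.\<close>
lemma box_family_cut:
  fixes \<A> :: "'a::euclidean_space set set"
  assumes F: "box_family \<A>" and i: "i \<in> Basis" and v: "0 \<le> v" "v \<le> measure lborel (\<Union>\<A>)"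
  shows "\<exists>d. measure lborel (\<Union>\<A> \<inter> {x. x \<bullet> i < d}) = v"
proof -
  define G where "G d = (\<Sum>A\<in>\<A>. measure lborel (A \<inter> {x. x \<bullet> i < d}))" for d
  have FG: "measure lborel (\<Union>\<A> \<inter> {x. x \<bullet> i < d}) = G d" for d
  proof -
    have "measure lborel (\<Union>A\<in>\<A>. A \<inter> {x. x \<bullet> i < d}) = G d"
      unfolding G_def
    proof (rule measure_finite_Union)
      show "disjoint_family_on (\<lambda>A. A \<inter> {x. x \<bullet> i < d}) \<A>"
        using F by (auto simp: box_family_def disjoint_family_on_def pairwise_def disjnt_def)
      show "emeasure lborel (A \<inter> {x. x \<bullet> i < d}) \<noteq> \<infinity>" if "A \<in> \<A>" for A
      proof -
        have "\<exists>a b. A = box a b" using F that unfolding box_family_def by blast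
        then show ?thesis
          by (metis box_Int_below[OF i] emeasure_lborel_box_finite infinity_ennreal_def less_irrefl)
      qed
    qed (use F in \<open>auto simp: box_family_def\<close>)
    then show ?thesis by (simp add: Int_commute Int_Union)
  qed
  have "continuous_on UNIV G"
    unfolding G_def
  proof (rule continuous_on_sum)
    fix A assume "A \<in> \<A>"
    then have "A \<noteq> {}" "\<exists>a b. A = box a b" using F by (simp_all add: box_family_def)
    then obtain a b where A: "A = box a b" and ne: "\<forall>j\<in>Basis. a \<bullet> j < b \<bullet> j"
      by (metis box_ne_empty(2))
    have "measure lborel (A \<inter> {x. x \<bullet> i < d})
        = max 0 (min (b \<bullet> i) d - a \<bullet> i) * (\<Prod>j\<in>Basis-{i}. (b - a) \<bullet> j)" for d
    proof -
      let ?b = "b + (min (b \<bullet> i) d - b \<bullet> i) *\<^sub>R i"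
      have bi: "?b \<bullet> i = min (b \<bullet> i) d" using i by (simp add: inner_simps)
      have bj: "?b \<bullet> j = b \<bullet> j" if "j \<in> Basis - {i}" for j
        using i that by (auto simp: inner_simps inner_Basis)
      have *: "(\<forall>j\<in>Basis. a \<bullet> j \<le> ?b \<bullet> j) \<longleftrightarrow> a \<bullet> i \<le> min (b \<bullet> i) d"
        using ne bi bj i by (metis DiffI less_imp_le singletonD)
      have "(\<Prod>j\<in>Basis. (?b - a) \<bullet> j) = (min (b \<bullet> i) d - a \<bullet> i) * (\<Prod>j\<in>Basis-{i}. (?b - a) \<bullet> j)"
        using i bi by (simp add: prod.remove[OF finite_Basis i] inner_diff_left)
      also have "(\<Prod>j\<in>Basis-{i}. (?b - a) \<bullet> j) = (\<Prod>j\<in>Basis-{i}. (b - a) \<bullet> j)"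
        using bj by (intro prod.cong) (auto simp: inner_diff_left)
      finally show ?thesis
        unfolding A box_Int_below[OF i] measure_lborel_box_eq * by auto
    qed
    then show "continuous_on UNIV (\<lambda>d. measure lborel (A \<inter> {x. x \<bullet> i < d}))"
      by (auto intro!: continuous_intros)
  qed
  moreover obtain R where R: "\<And>x. x \<in> \<Union>\<A> \<Longrightarrow> norm x \<le> R" 
    using box_family_bounded[OF F] by (auto simp: bounded_iff)
  have Ri: "\<bar>x \<bullet> i\<bar> \<le> R" if "x \<in> \<Union>\<A>" for x
    using R[OF that] Basis_le_norm[OF i, of x] by linarith
  have "\<Union>\<A> \<inter> {x. x \<bullet> i < - \<bar>R\<bar> - 1} = {}" "\<Union>\<A> \<inter> {x. x \<bullet> i < \<bar>R\<bar> + 1} = \<Union>\<A>"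
    using Ri by fastforce+
  then have "G (- \<bar>R\<bar> - 1) = 0" "G (\<bar>R\<bar> + 1) = measure lborel (\<Union>\<A>)"
    by (metis FG measure_empty, metis FG)
  ultimately have "\<exists>d. - \<bar>R\<bar> - 1 \<le> d \<and> d \<le> \<bar>R\<bar> + 1 \<and> G d = v"
    using v by (intro IVT') (auto intro: continuous_on_subset)
  then show ?thesis using FG by auto
qed

text \<open>Two disjoint boxes have disjoint projections to some axis. The hyperplane that separates them
  leaves on each side fewer boxes than there were, which is what the induction on the number of boxes
  needs.\<close>
lemma box_family_separate:
  fixes \<A> :: "'a::euclidean_space set set"
  assumes F: "box_family \<A>" and "2 \<le> card \<A>"
  obtains i c A A' where "i \<in> Basis" "A \<in> \<A>" "A' \<in> \<A>" "A \<inter> {x. c < x \<bullet> i} = {}" "A' \<inter> {x. x \<bullet> i < c} = {}"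
proof -
  obtain A A' where A: "A \<in> \<A>" "A' \<in> \<A>" "A \<noteq> A'"
    using assms(2) by (metis card_2_iff' card_le_Suc_iff numeral_2_eq_2 insertCI ex_card subsetD)
  obtain a b a' b' where ab: "A = box a b" "A' = box a' b'" and ne: "A \<noteq> {}" "A' \<noteq> {}"
    using F A unfolding box_family_def by meson
  have "box a b \<inter> box a' b' = {}"
    using F A ab unfolding box_family_def pairwise_def disjnt_def by blast
  then obtain i where i: "i \<in> Basis" and "b \<bullet> i \<le> a' \<bullet> i \<or> b' \<bullet> i \<le> a \<bullet> i"
    using ne ab unfolding disjoint_interval by (auto simp: box_ne_empty not_le[symmetric])
  then consider "b \<bullet> i \<le> a' \<bullet> i" | "b' \<bullet> i \<le> a \<bullet> i" by blast
  then show thesis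
  proof cases
    case 1
    show ?thesis
      by (rule that[OF i A(1,2), where c = "b \<bullet> i"]) (use 1 i ab in \<open>fastforce simp: box_def\<close>)+
  next
    case 2
    show ?thesis
      by (rule that[OF i A(2,1), where c = "b' \<bullet> i"]) (use 2 i ab in \<open>fastforce simp: box_def\<close>)+
  qed
qed

text \<open>Cut the first family by a hyperplane at height \<open>c\<close> that separates two of its boxes, and the
  second one at the height \<open>d\<close> that gives the lower parts the same volume. The sum of the lower
  parts lies below height \<open>c + d\<close> and the sum of the upper parts above it, so their volumes add up,
  and the induction hypothesis applies to each of them.\<close>
lemma brunn_minkowski_box_families_step:
  fixes \<A> \<B> :: "'a::euclidean_space set set"
  assumes A: "box_family \<A>" and B: "box_family \<B>"
    and eq: "measure lborel (\<Union>\<A>) = measure lborel (\<Union>\<B>)"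
    and two: "2 \<le> card \<A>"
    and IH: "\<And>\<A>' \<B>' :: 'a set set. card \<A>' + card \<B>' < card \<A> + card \<B> \<Longrightarrow> box_family \<A>' \<Longrightarrow> box_family \<B>' \<Longrightarrow>
      measure lborel (\<Union>\<A>') = measure lborel (\<Union>\<B>') \<Longrightarrow>
      2 ^ DIM('a) * measure lborel (\<Union>\<A>') \<le> measure lborel (\<Union>\<A>' + \<Union>\<B>')"
  shows "2 ^ DIM('a) * measure lborel (\<Union>\<A>) \<le> measure lborel (\<Union>\<A> + \<Union>\<B>)"
proof -
  obtain i c A1 A2 where i: "i \<in> Basis" and A12: "A1 \<in> \<A>" "A2 \<in> \<A>"
    and sep: "A1 \<inter> {x. c < x \<bullet> i} = {}" "A2 \<inter> {x. x \<bullet> i < c} = {}"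
    using box_family_separate[OF A two] by metis
  have fin: "finite \<A>" "finite \<B>" using A B by (auto simp: box_family_def)
  have fm: "\<Union>\<A> \<in> fmeasurable lborel" "\<Union>\<B> \<in> fmeasurable lborel"
    using A B by (auto intro!: fmeasurable_bounded_open box_family_open box_family_bounded)
  have below: "\<exists>a' b'. box a b \<inter> {x. x \<bullet> i < e} = box a' b'" for a b e
    using box_Int_below[OF i] by blast
  have above: "\<exists>a' b'. box a b \<inter> {x. e < x \<bullet> i} = box a' b'" for a b e
    using box_Int_above[OF i] by blast
  note splitA = measure_split_hyperplane[OF i fm(1), of c]
  \<comment> \<open>Cut the other family in the same ratio of volumes.\<close>
  obtain d where d: "measure lborel (\<Union>\<B> \<inter> {x. x \<bullet> i < d}) = measure lborel (\<Union>\<A> \<inter> {x. x \<bullet> i < c})"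
    using box_family_cut[OF B i, of "measure lborel (\<Union>\<A> \<inter> {x. x \<bullet> i < c})"] splitA eq by auto
  note splitB = measure_split_hyperplane[OF i fm(2), of d]
  let ?Am = "\<Union>\<A> \<inter> {x. x \<bullet> i < c}" and ?Bm = "\<Union>\<B> \<inter> {x. x \<bullet> i < d}"
  let ?Ap = "\<Union>\<A> \<inter> {x. c < x \<bullet> i}" and ?Bp = "\<Union>\<B> \<inter> {x. d < x \<bullet> i}"
  have m: "2 ^ DIM('a) * measure lborel ?Am \<le> measure lborel (?Am + ?Bm)"
    unfolding Union_family_restrict[symmetric]
    by (rule IH, intro add_less_le_mono card_family_restrict_less[OF fin(1) A12(2) sep(2)]
          card_family_restrict_le fin)
       (use A B d in \<open>auto intro!: box_family_restrict below simp only: Union_family_restrict\<close>)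
  have p: "2 ^ DIM('a) * measure lborel ?Ap \<le> measure lborel (?Ap + ?Bp)"
    unfolding Union_family_restrict[symmetric]
    by (rule IH, intro add_less_le_mono card_family_restrict_less[OF fin(1) A12(1) sep(1)]
          card_family_restrict_le fin)
       (use A B d splitA splitB eq in \<open>auto intro!: box_family_restrict above simp only: Union_family_restrict\<close>)
  let ?C = "\<Union>\<A> + \<Union>\<B>"
  have C: "?C \<in> fmeasurable lborel"
    using A B by (intro fmeasurable_bounded_open open_set_plus bounded_set_plus box_family_open box_family_bounded)
  have Cm: "?C \<inter> {x. x \<bullet> i < c + d} \<in> fmeasurable lborel" "?C \<inter> {x. c + d < x \<bullet> i} \<in> fmeasurable lborel"
    using C by (auto intro!: fmeasurable_Int_fmeasurable)
  have op: "open ?Am" "open ?Ap"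
    using box_family_open[OF A] by (auto intro!: open_Int open_halfspace_component_lt open_halfspace_component_gt)
  have "2 ^ DIM('a) * measure lborel (\<Union>\<A>) = 2 ^ DIM('a) * measure lborel ?Am + 2 ^ DIM('a) * measure lborel ?Ap"
    by (simp add: splitA distrib_left)
  also have "\<dots> \<le> measure lborel (?Am + ?Bm) + measure lborel (?Ap + ?Bp)"
    using m p by linarith
  also have "\<dots> \<le> measure lborel (?C \<inter> {x. x \<bullet> i < c + d}) + measure lborel (?C \<inter> {x. c + d < x \<bullet> i})"
  proof (rule add_mono; rule measure_mono_fmeasurable[OF _ _ Cm(1)] measure_mono_fmeasurable[OF _ _ Cm(2)])
    show "?Am + ?Bm \<subseteq> ?C \<inter> {x. x \<bullet> i < c + d}" "?Ap + ?Bp \<subseteq> ?C \<inter> {x. c + d < x \<bullet> i}"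
      by (force simp: set_plus_def inner_simps)+
    show "?Am + ?Bm \<in> sets lborel" "?Ap + ?Bp \<in> sets lborel"
      using op[THEN open_set_plus] by auto
  qed
  also have "\<dots> = measure lborel ?C"
    using measure_split_hyperplane[OF i C] by simp
  finally show ?thesis .
qed

lemma brunn_minkowski_box_families:
  fixes \<A> \<B> :: "'a::euclidean_space set set"
  assumes "box_family \<A>" and "box_family \<B>"
    and "measure lborel (\<Union>\<A>) = measure lborel (\<Union>\<B>)"
  shows "2 ^ DIM('a) * measure lborel (\<Union>\<A>) \<le> measure lborel (\<Union>\<A> + \<Union>\<B>)"
  using assms
proof (induction "card \<A> + card \<B>" arbitrary: \<A> \<B> rule: less_induct)
  case less
  have fin: "finite \<A>" "finite \<B>" using less.prems by (auto simp: box_family_def)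
  consider "2 \<le> card \<A>" | "2 \<le> card \<B>" | "card \<A> = 0 \<or> card \<B> = 0" | "card \<A> = 1" "card \<B> = 1"
    by linarith
  then show ?case
  proof cases
    case 1
    then show ?thesis using brunn_minkowski_box_families_step less by blast
  next
    case 2
    have "2 ^ DIM('a) * measure lborel (\<Union>\<B>) \<le> measure lborel (\<Union>\<B> + \<Union>\<A>)"
      by (rule brunn_minkowski_box_families_step) (use 2 less in \<open>auto simp: add.commute\<close>)
    then show ?thesis using less.prems by (simp add: add.commute)
  next
    case 3
    then have "measure lborel (\<Union>\<A>) = 0" using fin less.prems(3) by auto
    then show ?thesis by simp
  next
    case 4
    then obtain A B where AB: "\<A> = {A}" "\<B> = {B}" by (meson card_1_singletonE)
    then obtain a b c d where "A = box a b" "B = box c d" "A \<noteq> {}" "B \<noteq> {}"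
      using less.prems unfolding box_family_def by (metis singletonI)
    then show ?thesis using brunn_minkowski_boxes[of a b c d] less.prems(3) AB by simp
  qed
qed

text \<open>An open set is a countable union of closed boxes. A finite union of them has almost full volume,
  and its division into closed boxes with disjoint interiors loses only the null set of the frontiers
  when these are removed.\<close>
lemma box_family_inner_approximation:
  fixes U :: "'a::euclidean_space set"
  assumes U: "open U" and v: "ennreal v < emeasure lborel U" 
  obtains \<A> where "box_family \<A>" "\<Union>\<A> \<subseteq> U" "v < measure lborel (\<Union>\<A>)"
proof -
  obtain \<D> where D: "countable \<D>" "\<D> \<subseteq> Pow U" "\<And>X. X \<in> \<D> \<Longrightarrow> \<exists>a b. X = cbox a b" "\<Union>\<D> = U"
    using open_countable_Union_open_cbox[OF U] by metis
  have "U \<noteq> {}" using v by auto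
  then have "\<D> \<noteq> {}" using D(4) by auto
  then obtain e :: "nat \<Rightarrow> 'a set" where e: "range e = \<D>"
    using D(1) by (metis uncountable_def)
  define W where "W k = (\<Union>j\<le>k. e j)" for k
  have eb: "\<exists>a b. e j = cbox a b" for j using D(3) e by blast
  have Wm: "W k \<in> sets lborel" for k
    unfolding W_def using eb by (intro sets.finite_UN) (auto, metis borel_closed closed_cbox)
  have "(\<lambda>k. emeasure lborel (W k)) \<longlonglongrightarrow> emeasure lborel (\<Union>k. W k)"
    by (rule Lim_emeasure_incseq) (use Wm in \<open>auto simp: incseq_def W_def intro: order_trans\<close>)
  moreover have "(\<Union>k. W k) = U" using D(4) e by (auto simp: W_def)
  ultimately have "\<forall>\<^sub>F k in sequentially. ennreal v < emeasure lborel (W k)"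
    using v order_tendstoD(1) by metis
  then obtain k where k: "ennreal v < emeasure lborel (W k)"
    by (auto simp: eventually_sequentially)
  obtain p where p: "p division_of W k"
    unfolding W_def by (rule elementary_unions_intervals[of "e ` {..k}"]) (use eb in auto)
  \<comment> \<open>Members of a family are nonempty, whereas a degenerate box has empty interior.\<close>
  define \<A> where "\<A> = interior ` p - {{}}"
  have "box_family \<A>"
    unfolding box_family_def
  proof (intro conjI ballI)
    show "finite \<A>" using p by (auto simp: \<A>_def)
    show "disjoint \<A>"
      using division_ofD(5)[OF p] by (auto simp: \<A>_def pairwise_def disjnt_def)
    show "\<exists>a b. A = box a b" if "A \<in> \<A>" for A
      using that division_ofD(4)[OF p] interior_cbox unfolding \<A>_def by blast
  qed (auto simp: \<A>_def)
  moreover have "\<Union>\<A> \<subseteq> U"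
  proof -
    have "\<Union>\<A> \<subseteq> \<Union>p" using interior_subset by (fastforce simp: \<A>_def)
    also have "\<Union>p = W k" by (rule division_ofD(6)[OF p])
    also have "\<dots> \<subseteq> U" using \<open>(\<Union>k. W k) = U\<close> by blast
    finally show ?thesis .
  qed
  moreover have "v < measure lborel (\<Union>\<A>)"
  proof -
    have "W k - \<Union>\<A> \<subseteq> (\<Union>K\<in>p. frontier K)"
    proof
      fix x assume x: "x \<in> W k - \<Union>\<A>"
      then obtain K where K: "K \<in> p" "x \<in> K" using division_ofD(6)[OF p] by blast
      then have "x \<notin> interior K" using x by (auto simp: \<A>_def)
      then show "x \<in> (\<Union>K\<in>p. frontier K)"
        using K closure_subset by (fastforce simp: frontier_def)
    qed
    moreover have "(\<Union>K\<in>p. frontier K) \<in> null_sets lborel"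
    proof (intro null_sets.finite_UN)
      fix K assume "K \<in> p"
      then obtain a b where "K = cbox a b" using division_ofD(4)[OF p] by blast
      then have "negligible (frontier K)" by (simp add: negligible_convex_frontier)
      then show "frontier K \<in> null_sets lborel"
        by (simp add: negligible_iff_null_sets null_sets_completion_iff)
    qed (use p in auto)
    ultimately have "emeasure lborel (W k) \<le> emeasure lborel (\<Union>\<A> \<union> (\<Union>K\<in>p. frontier K))"
      using box_family_open[OF \<open>box_family \<A>\<close>] by (intro emeasure_mono) (auto intro!: sets.Un)
    also have "\<dots> = emeasure lborel (\<Union>\<A>)"
      using \<open>(\<Union>K\<in>p. frontier K) \<in> null_sets lborel\<close> box_family_open[OF \<open>box_family \<A>\<close>]
      by (intro emeasure_Un_null_set) auto
    also have "\<dots> = ennreal (measure lborel (\<Union>\<A>))"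
      using \<open>box_family \<A>\<close>
      by (intro emeasure_eq_measure2 fmeasurable_bounded_open box_family_open box_family_bounded)
    finally show ?thesis using k by (metis ennreal_leI less_le_trans not_less)
  qed
  ultimately show thesis using that by blast
qed

text \<open>A finite family of boxes inside \<open>U\<close> has the same volume as its reflection, so the inequality for
  families applies to the two of them; the family may be chosen of volume arbitrarily close to that
  of \<open>U\<close>.\<close>
lemma brunn_minkowski_difference_open:
  fixes U :: "'a::euclidean_space set"
  assumes U: "open U" "bounded U"
  shows "2 ^ DIM('a) * measure lborel U \<le> measure lborel (U + uminus ` U)"
proof (rule ccontr)
  define w where "w = measure lborel (U + uminus ` U) / 2 ^ DIM('a)"
  have fmD: "U + uminus ` U \<in> fmeasurable lborel"
    using U by (intro fmeasurable_bounded_open open_set_plus bounded_set_plus) auto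
  assume "\<not> ?thesis"
  then have "w < measure lborel U" by (simp add: w_def field_simps)
  then have "ennreal w < emeasure lborel U"
    using fmeasurable_bounded_open[OF U] by (simp add: emeasure_eq_measure2 w_def ennreal_less_iff)
  then obtain \<A> where A: "box_family \<A>" "\<Union>\<A> \<subseteq> U" "w < measure lborel (\<Union>\<A>)"
    using box_family_inner_approximation[OF U(1)] by metis
  define \<B> where "\<B> = (`) uminus ` \<A>"
  have UB: "\<Union>\<B> = uminus ` \<Union>\<A>" unfolding \<B>_def by auto
  have um: "uminus ` box a b = box (- b) (- a)" for a b :: 'a
  proof
    show "box (- b) (- a) \<subseteq> uminus ` box a b"
    proof
      fix x assume "x \<in> box (- b) (- a)"
      then have "- x \<in> box a b" by (fastforce simp: box_def)
      then show "x \<in> uminus ` box a b" by (metis image_eqI minus_minus)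
    qed
  qed (auto simp: box_def)
  have B: "box_family \<B>"
    unfolding box_family_def
  proof (intro conjI ballI)
    show "finite \<B>" using A(1) by (simp add: box_family_def \<B>_def)
    show "disjoint \<B>"
    proof (rule pairwiseI)
      fix X Y assume "X \<in> \<B>" "Y \<in> \<B>" "X \<noteq> Y"
      then obtain X' Y' where "X = uminus ` X'" "Y = uminus ` Y'" "X' \<in> \<A>" "Y' \<in> \<A>" "X' \<noteq> Y'"
        unfolding \<B>_def by blast
      moreover from this have "X' \<inter> Y' = {}"
        using A(1) by (meson box_family_def disjnt_def pairwiseD)
      ultimately show "disjnt X Y" by (auto simp: disjnt_def)
    qed
    fix B assume "B \<in> \<B>"
    then obtain A' where A': "A' \<in> \<A>" "B = uminus ` A'" by (auto simp: \<B>_def)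
    have "A' \<noteq> {}" "\<exists>a b. A' = box a b" using A' A(1) by (simp_all add: box_family_def)
    then show "B \<noteq> {}" "\<exists>a b. B = box a b" unfolding A'(2) using um by (blast, metis)
  qed
  have "2 ^ DIM('a) * measure lborel (\<Union>\<A>) \<le> measure lborel (\<Union>\<A> + \<Union>\<B>)"
    using A(1) B box_family_open[OF A(1)]
    by (intro brunn_minkowski_box_families) (auto simp: UB measure_uminus_image)
  also have "\<dots> \<le> measure lborel (U + uminus ` U)"
    using A fmD box_family_open[OF A(1)] unfolding UB
    by (intro measure_mono_fmeasurable set_plus_mono2 image_mono)
       (auto intro!: borel_open open_set_plus)
  finally show False using A(3) by (simp add: w_def field_simps)
qed

text \<open>The frontier of a convex set is a null set, so the open case for the interior is enough.\<close>
lemma brunn_minkowski_difference: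
  fixes M :: "'a::euclidean_space set"
  assumes M: "compact M" "convex M"
  shows "2 ^ DIM('a) * measure lborel M \<le> measure lborel (M + uminus ` M)"
proof -
  have c: "compact (M + uminus ` M)" using M by (intro compact_set_plus compact_negations)
  have "negligible (frontier M)" using M by (simp add: negligible_convex_frontier)
  then have n: "frontier M \<in> null_sets lborel"
    by (simp add: negligible_iff_null_sets null_sets_completion_iff)
  have "measure lborel M = measure lborel (M - frontier M)"
    using M n by (simp add: measure_Diff_null_set compact_imp_closed)
  also have "M - frontier M = interior M"
    using M by (auto simp: frontier_def compact_imp_closed dest: interior_subset[THEN subsetD])
  finally have "2 ^ DIM('a) * measure lborel M \<le> measure lborel (interior M + uminus ` interior M)"
    using brunn_minkowski_difference_open[of "interior M"] M compact_imp_bounded interior_subset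
    by (metis bounded_subset open_interior)
  also have "\<dots> \<le> measure lborel (M + uminus ` M)"
    using c by (intro measure_mono_fmeasurable set_plus_mono2 image_mono interior_subset fmeasurable_compact)
               (auto intro!: borel_open open_set_plus)
  finally show ?thesis .
qed

section \<open>The Rogers--Shephard inequality and its equality case\<close>

text \<open>The density \<open>n (1 - l) ^ (n - 1)\<close> on the unit interval writes \<open>(1 - p) ^ n\<close> as an
  integral over the scaling factors \<open>l \<ge> p\<close>. This lets the integral of \<open>(1 - p x) ^ n\<close>, with \<open>p\<close> the
  gauge of a body, be computed from the volumes of its multiples alone.\<close>
lemma nn_integral_radial_weight:
  assumes "0 < n" "p \<le> 1"
  shows "(\<integral>\<^sup>+l. ennreal (real n * (1 - l) ^ (n - 1)) * indicator {p..1} l \<partial>lborel) = ennreal ((1 - p) ^ n)"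
proof -
  have "(\<integral>\<^sup>+l. ennreal (real n * (1 - l) ^ (n - 1)) * indicator {p..1} l \<partial>lborel)
      = ennreal (- ((1 - 1) ^ n) - - ((1 - p) ^ n))"
  proof (rule nn_integral_FTC_Icc)
    show "((\<lambda>l. - ((1 - l) ^ n)) has_real_derivative (real n * (1 - x) ^ (n - 1))) (at x)" for x :: real
      by (rule derivative_eq_intros refl)+ (simp add: mult.commute)
  qed (use assms in auto)
  then show ?thesis using assms by simp
qed

text \<open>The source of the binomial coefficient: \<open>n\<close> times the Beta integral with parameters \<open>n + 1\<close> and
  \<open>n\<close>.\<close>
lemma nn_integral_radial_weight_power:
  assumes "0 < n"
  shows "(\<integral>\<^sup>+l. ennreal (real n * (1 - l) ^ (n - 1) * l ^ n) * indicator {0..1} l \<partial>lborel)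
    = ennreal (1 / real ((2 * n) choose n))"
proof -
  have "Beta (real (Suc n)) (real n) = fact n * fact (n - 1) / fact (2 * n)"
  proof -
    have "Gamma (real (Suc n)) = fact n" "Gamma (real n) = fact (n - 1)" "Gamma (real (Suc (2 * n))) = fact (2 * n)"
      using Gamma_fact[of n, where ?'a = real] Gamma_fact[of "n - 1", where ?'a = real]
        Gamma_fact[of "2 * n", where ?'a = real] assms by (simp_all add: add.commute of_nat_diff)
    moreover have "real (Suc n) + real n = real (Suc (2 * n))" by simp
    ultimately show ?thesis unfolding Beta_def by metis
  qed
  then have B: "real n * Beta (real (Suc n)) (real n) = 1 / real ((2 * n) choose n)"
    using assms binomial_fact[of n "2 * n", where ?'a = real]
    by (simp add: fact_reduce[of n, where ?'a = real] mult_2)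
  have "((\<lambda>t. t powr (real (Suc n) - 1) * (1 - t) powr (real n - 1)) has_integral Beta (real (Suc n)) (real n)) {0..1}"
    using assms by (intro has_integral_Beta_real) auto
  then have "((\<lambda>t. t ^ n * (1 - t) ^ (n - 1)) has_integral Beta (real (Suc n)) (real n)) {0..1}"
  proof (rule has_integral_spike_finite[rotated 2])
    show "finite {0, 1 :: real}" by simp
    fix t :: real assume "t \<in> {0..1} - {0, 1}"
    then show "t ^ n * (1 - t) ^ (n - 1) = t powr (real (Suc n) - 1) * (1 - t) powr (real n - 1)"
      using assms powr_realpow[of t n] powr_realpow[of "1 - t" "n - 1"] by (simp add: of_nat_diff)
  qed
  then have I: "((\<lambda>t. real n * (1 - t) ^ (n - 1) * t ^ n) has_integral (1 / real ((2 * n) choose n))) {0..1}"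
    using has_integral_mult_right[of _ "Beta (real (Suc n)) (real n)" "{0..1}" "real n"] B
    by (simp only: mult.assoc mult.commute[of "_ ^ n"])
  then show ?thesis by (intro nn_integral_has_integral_lebesgue') auto
qed

lemma compact_scaled_graph:
  fixes D :: "'a::euclidean_space set"
  assumes "compact D"
  shows "compact {(x, l). l \<in> {0..1} \<and> x \<in> (*\<^sub>R) l ` D}"
proof -
  have "{(x, l). l \<in> {0..1} \<and> x \<in> (*\<^sub>R) l ` D} = (\<lambda>(l, d). (l *\<^sub>R d, l)) ` ({0..1} \<times> D)"
    by (auto simp: image_iff)
  moreover have "compact \<dots>"
    using assms by (intro compact_continuous_image compact_Times)
      (auto simp: case_prod_unfold intro!: continuous_intros)
  ultimately show ?thesis by simp
qed

text \<open>The parametrization of the scaled copies by \<open>(l, d) \<mapsto> (l d, l)\<close> shows the compactness of their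
  graph, from which the measurability needed for Fubini follows.\<close>
lemma measurable_scaled_graph:
  fixes D :: "'a::euclidean_space set"
  assumes "compact D"
  shows "{(x, l). l \<in> {0..1} \<and> x \<in> (*\<^sub>R) l ` D} \<in> sets (borel \<Otimes>\<^sub>M borel)"
  unfolding borel_prod by (rule borel_compact[OF compact_scaled_graph[OF assms]])

text \<open>For a compact convex set \<open>D\<close> containing 0, this is \<open>(1 - p x) ^ n\<close> on \<open>D\<close> and 0 elsewhere, where
  \<open>p\<close> is the gauge of \<open>D\<close> and \<open>n\<close> the dimension. The integral form avoids the gauge itself: only
  the relation \<open>x \<in> l D\<close> is used.\<close>
definition gauge_weight :: "'a::euclidean_space set \<Rightarrow> 'a \<Rightarrow> ennreal" where
  "gauge_weight D x = (\<integral>\<^sup>+l. ennreal (real DIM('a) * (1 - l) ^ (DIM('a) - 1)) *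
     indicator {l. l \<in> {0..1} \<and> x \<in> (*\<^sub>R) l ` D} l \<partial>lborel)"

lemma gauge_weight_measurable:
  fixes D :: "'a::euclidean_space set"
  assumes "compact D"
  shows "gauge_weight D \<in> borel_measurable borel"
proof -
  define G where "G = {(x, l). l \<in> {0..1} \<and> x \<in> (*\<^sub>R) l ` D}"
  have G [measurable]: "G \<in> sets (borel \<Otimes>\<^sub>M borel)"
    unfolding G_def by (rule measurable_scaled_graph[OF assms])
  have "gauge_weight D = (\<lambda>x. \<integral>\<^sup>+l. ennreal (real DIM('a) * (1 - l) ^ (DIM('a) - 1)) * indicator G (x, l) \<partial>lborel)"
    unfolding gauge_weight_def G_def by (intro ext nn_integral_cong) (auto simp: indicator_def)
  also have "\<dots> \<in> borel_measurable borel" by measurable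
  finally show ?thesis .
qed

text \<open>By Fubini, the inner integral is the volume \<open>l ^ n\<close> times that of \<open>D\<close>, and the Beta integral
  remains.\<close>
lemma nn_integral_gauge_weight:
  fixes D :: "'a::euclidean_space set"
  assumes "compact D"
  shows "(\<integral>\<^sup>+x. gauge_weight D x \<partial>lborel) = ennreal (1 / real ((2 * DIM('a)) choose DIM('a))) * emeasure lborel D"
proof -
  define G where "G = {(x, l). l \<in> {0..1} \<and> x \<in> (*\<^sub>R) l ` D}"
  define w where "w l = ennreal (real DIM('a) * (1 - l) ^ (DIM('a) - 1))" for l :: real
  have G [measurable]: "G \<in> sets (borel \<Otimes>\<^sub>M borel)"
    unfolding G_def by (rule measurable_scaled_graph[OF assms])
  have w [measurable]: "w \<in> borel_measurable borel" unfolding w_def by measurable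
  have "(\<integral>\<^sup>+x. gauge_weight D x \<partial>lborel) = (\<integral>\<^sup>+x. \<integral>\<^sup>+l. w l * indicator G (x, l) \<partial>lborel \<partial>lborel)"
    unfolding gauge_weight_def w_def G_def
    by (intro nn_integral_cong) (auto simp: indicator_def)
  also have "\<dots> = (\<integral>\<^sup>+l. \<integral>\<^sup>+x. w l * indicator G (x, l) \<partial>lborel \<partial>lborel)"
    by (rule lborel_pair.Fubini'[symmetric]) measurable
  also have "\<dots> = (\<integral>\<^sup>+l. ennreal (real DIM('a) * (1 - l) ^ (DIM('a) - 1) * l ^ DIM('a)) * indicator {0..1} l * emeasure lborel D \<partial>lborel)"
  proof (intro nn_integral_cong)
    fix l :: real
    show "(\<integral>\<^sup>+x. w l * indicator G (x, l) \<partial>lborel)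
      = ennreal (real DIM('a) * (1 - l) ^ (DIM('a) - 1) * l ^ DIM('a)) * indicator {0..1} l * emeasure lborel D"
    proof (cases "l \<in> {0..1}")
      case True
      have D: "D \<in> sets borel" using assms by (simp add: borel_closed compact_imp_closed)
      have lD: "(*\<^sub>R) l ` D \<in> sets borel"
        using assms compact_scaling[of D l] by (simp add: borel_closed compact_imp_closed)
      have "(\<integral>\<^sup>+x. w l * indicator G (x, l) \<partial>lborel) = (\<integral>\<^sup>+x. w l * indicator ((*\<^sub>R) l ` D) x \<partial>lborel)"
        using True by (intro nn_integral_cong) (auto simp: G_def indicator_def)
      also have "\<dots> = w l * emeasure lborel ((*\<^sub>R) l ` D)"
        using lD by (simp add: nn_integral_cmult_indicator)
      also have "emeasure lborel ((*\<^sub>R) l ` D) = ennreal (l ^ DIM('a)) * emeasure lborel D"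
        using emeasure_affine_image[OF D, of 0 l] True by simp
      finally show ?thesis
        using True by (simp add: w_def ennreal_mult mult.assoc)
    next
      case False
      then have "indicator G (x, l) = (0::ennreal)" for x by (auto simp: G_def indicator_def)
      then show ?thesis using False by simp
    qed
  qed
  also have "\<dots> = ennreal (1 / real ((2 * DIM('a)) choose DIM('a))) * emeasure lborel D"
    using nn_integral_radial_weight_power[of "DIM('a)"] by (simp add: nn_integral_multc)
  finally show ?thesis .
qed

text \<open>By Fubini: for fixed \<open>y\<close> the translations \<open>x\<close> with \<open>y \<in> x + K\<close> form the reflected body
  \<open>y - K\<close>.\<close>
lemma nn_integral_covariogram:
  fixes K :: "'a::euclidean_space set"
  assumes [measurable]: "K \<in> sets borel"
  shows "(\<integral>\<^sup>+x. emeasure lborel (K \<inter> (+) x ` K) \<partial>lborel) = emeasure lborel K * emeasure lborel K"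
proof -
  have tr: "(+) x ` K = {y. y - x \<in> K}" for x
    by (force simp: image_iff)
  have "(\<integral>\<^sup>+x. emeasure lborel (K \<inter> (+) x ` K) \<partial>lborel)
      = (\<integral>\<^sup>+x. \<integral>\<^sup>+y. indicator K y * indicator K (y - x) \<partial>lborel \<partial>lborel)"
  proof (intro nn_integral_cong)
    fix x :: 'a
    have m: "K \<inter> {y. y - x \<in> K} \<in> sets borel" by measurable
    have "emeasure lborel (K \<inter> {y. y - x \<in> K}) = (\<integral>\<^sup>+y. indicator (K \<inter> {y. y - x \<in> K}) y \<partial>lborel)"
      using m by (simp add: nn_integral_indicator)
    also have "\<dots> = (\<integral>\<^sup>+y. indicator K y * indicator K (y - x) \<partial>lborel)"
      by (intro nn_integral_cong) (auto simp: indicator_def)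
    finally show "emeasure lborel (K \<inter> (+) x ` K) = (\<integral>\<^sup>+y. indicator K y * indicator K (y - x) \<partial>lborel)"
      by (simp add: tr)
  qed
  also have "\<dots> = (\<integral>\<^sup>+y. \<integral>\<^sup>+x. indicator K y * indicator K (y - x) \<partial>lborel \<partial>lborel)"
    by (rule lborel_pair.Fubini'[symmetric]) measurable
  also have "\<dots> = (\<integral>\<^sup>+y. indicator K y * emeasure lborel K \<partial>lborel)"
  proof (intro nn_integral_cong)
    fix y :: 'a
    have im: "{x. y - x \<in> K} = (\<lambda>k. y + (-1) *\<^sub>R k) ` K"
      by (force simp: image_iff intro: bexI[of _ "y - x" for x])
    have "(\<integral>\<^sup>+x. indicator K (y - x) \<partial>lborel) = (\<integral>\<^sup>+x. indicator {x. y - x \<in> K} x \<partial>lborel)"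
      by (intro nn_integral_cong) (auto simp: indicator_def)
    also have "\<dots> = emeasure lborel {x. y - x \<in> K}" by (rule nn_integral_indicator) measurable
    also have "\<dots> = emeasure lborel K"
      unfolding im using emeasure_affine_image[OF assms, of y "-1"] by simp
    finally show "(\<integral>\<^sup>+x. indicator K y * indicator K (y - x) \<partial>lborel) = indicator K y * emeasure lborel K"
      by (simp add: nn_integral_cmult)
  qed
  also have "\<dots> = emeasure lborel K * emeasure lborel K"
    by (simp add: nn_integral_multc)
  finally show ?thesis .
qed

text \<open>A convex null set lies in a hyperplane, and its differences lie in the parallel linear
  hyperplane.\<close>
lemma convex_null_difference:
  fixes K :: "'a::euclidean_space set"
  assumes "compact K" "convex K" "emeasure lborel K = 0"
  shows "emeasure lborel (K + uminus ` K) = 0"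
proof -
  have "K \<in> null_sets lborel" using assms by (auto simp: null_sets_def compact_imp_closed)
  then have "negligible K" by (simp add: negligible_iff_null_sets null_sets_completionI)
  then have "interior K = {}" using negligible_convex_interior[OF assms(2)] by simp
  then obtain a b where ab: "a \<noteq> 0" "K \<subseteq> {x. a \<bullet> x = b}"
    using empty_interior_subset_hyperplane[OF assms(2)] by metis
  then have "a \<bullet> x = b" if "x \<in> K" for x using that by auto
  then have "K + uminus ` K \<subseteq> {x. a \<bullet> x = 0}" by (auto simp: set_plus_def inner_simps)
  then have "negligible (K + uminus ` K)"
    using negligible_hyperplane[of a 0] ab(1) negligible_subset by blast
  then show ?thesis
    using compact_set_plus[OF assms(1) compact_negations[OF assms(1)]]
    by (simp add: negligible_iff_emeasure0 compact_imp_closed)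
qed

text \<open>If \<open>x = l (a - b)\<close>, both \<open>K\<close> and \<open>x + K\<close> contain the homothetic copy \<open>l a + (1 - l) K\<close>, by
  convexity.\<close>
lemma emeasure_Int_translate_ge:
  fixes K :: "'a::euclidean_space set"
  assumes K: "compact K" "convex K" and l: "l \<in> {0..1}" and x: "x \<in> (*\<^sub>R) l ` (K + uminus ` K)"
  shows "ennreal ((1 - l) ^ DIM('a)) * emeasure lborel K \<le> emeasure lborel (K \<inter> (+) x ` K)"
proof -
  obtain a b where ab: "a \<in> K" "b \<in> K" "x = l *\<^sub>R (a - b)" using x by (auto simp: set_plus_def)
  have "ennreal ((1 - l) ^ DIM('a)) * emeasure lborel K = emeasure lborel ((\<lambda>k. l *\<^sub>R a + (1 - l) *\<^sub>R k) ` K)"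
    using emeasure_affine_image[of K "l *\<^sub>R a" "1 - l"] K l by (simp add: compact_imp_closed)
  also have "\<dots> \<le> emeasure lborel (K \<inter> (+) x ` K)"
  proof (rule emeasure_mono)
    show "(\<lambda>k. l *\<^sub>R a + (1 - l) *\<^sub>R k) ` K \<subseteq> K \<inter> (+) x ` K"
    proof (clarify, rule IntI)
      fix k assume k: "k \<in> K"
      show "l *\<^sub>R a + (1 - l) *\<^sub>R k \<in> K"
        using K(2) ab k l by (auto simp: convex_alt intro: convexD)
      have "l *\<^sub>R b + (1 - l) *\<^sub>R k \<in> K"
        using K(2) ab k l by (auto intro: convexD)
      moreover have "l *\<^sub>R a + (1 - l) *\<^sub>R k = x + (l *\<^sub>R b + (1 - l) *\<^sub>R k)"
        using ab by (simp add: algebra_simps)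
      ultimately show "l *\<^sub>R a + (1 - l) *\<^sub>R k \<in> (+) x ` K" by blast
    qed
    have "closed (K \<inter> (+) x ` K)" using K by (intro closed_Int compact_imp_closed compact_translation)
    then show "K \<inter> (+) x ` K \<in> sets lborel" by simp
  qed
  finally show ?thesis .
qed

text \<open>The covariogram divided by the volume of \<open>K\<close>, called \<open>u\<close>, satisfies \<open>(1 - l) ^ n \<le> u\<close> for all
  scaling factors \<open>l\<close> that count for the weight of \<open>x\<close>. These are thus at least \<open>1 - root n u\<close>, so that
  the weight is at most \<open>u\<close>. Integration over \<open>x\<close> gives the claim.\<close>
lemma rogers_shephard:
  fixes K :: "'a::euclidean_space set"
  assumes K: "compact K" "convex K"
  shows "emeasure lborel (K + uminus ` K) \<le> ennreal (real ((2 * DIM('a)) choose DIM('a))) * emeasure lborel K"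
proof (cases "emeasure lborel K = 0")
  case True
  then show ?thesis using convex_null_difference[OF K] by simp
next
  case False
  define D where "D = K + uminus ` K"
  define v where "v = measure lborel K"
  have cD: "compact D" unfolding D_def using K by (intro compact_set_plus compact_negations)
  have eK: "emeasure lborel K = ennreal v"
    unfolding v_def using K by (intro emeasure_eq_measure2 fmeasurable_compact)
  then have v: "0 < v" using False v_def measure_nonneg[of lborel K] by (metis ennreal_0 less_eq_real_def)
  let ?N = "DIM('a)" let ?C = "real ((2 * DIM('a)) choose DIM('a))"
  have C: "0 < ?C" by simp
  have le: "ennreal v * gauge_weight D x \<le> emeasure lborel (K \<inter> (+) x ` K)" for x
  proof -
    define u where "u = measure lborel (K \<inter> (+) x ` K) / v"
    have cI: "compact (K \<inter> (+) x ` K)" using K by (intro compact_Int compact_translation)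
    then have eI: "emeasure lborel (K \<inter> (+) x ` K) = ennreal (v * u)"
      using v unfolding u_def by (simp add: emeasure_eq_measure2 fmeasurable_compact)
    have u: "0 \<le> u" using v by (simp add: u_def)
    have lu: "(1 - l) ^ ?N \<le> u" if "l \<in> {0..1}" "x \<in> (*\<^sub>R) l ` D" for l
    proof -
      have "ennreal ((1 - l) ^ ?N * v) \<le> ennreal (v * u)"
        using emeasure_Int_translate_ge[OF K that(1), of x] that v unfolding D_def eI eK by (simp add: ennreal_mult)
      then have "(1 - l) ^ ?N * v \<le> v * u" using v u by (subst (asm) ennreal_le_iff) auto
      then show ?thesis using v by (metis mult.commute mult_le_cancel_left_pos)
    qed
    have "gauge_weight D x \<le> (\<integral>\<^sup>+l. ennreal (real ?N * (1 - l) ^ (?N - 1)) * indicator {1 - root ?N u..1} l \<partial>lborel)"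
      unfolding gauge_weight_def
    proof (intro nn_integral_mono mult_left_mono)
      fix l :: real
      have "1 - root ?N u \<le> l" if "l \<in> {0..1}" "x \<in> (*\<^sub>R) l ` D"
      proof -
        have "root ?N ((1 - l) ^ ?N) \<le> root ?N u" using lu[OF that] by (intro real_root_le_mono) auto
        moreover have "root ?N ((1 - l) ^ ?N) = 1 - l" using that by (intro real_root_power_cancel) auto
        ultimately show ?thesis by linarith
      qed
      then show "(indicator {l. l \<in> {0..1} \<and> x \<in> (*\<^sub>R) l ` D} l :: ennreal) \<le> indicator {1 - root ?N u..1} l"
        by (auto simp: indicator_def)
    qed auto
    also have "\<dots> = ennreal ((1 - (1 - root ?N u)) ^ ?N)"
      using u by (intro nn_integral_radial_weight) auto
    also have "\<dots> = ennreal u" using u by simp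
    finally show ?thesis using v u eI by (simp add: ennreal_mult mult_left_mono)
  qed
  have "ennreal v * (ennreal (1 / ?C) * emeasure lborel D) = ennreal v * (\<integral>\<^sup>+x. gauge_weight D x \<partial>lborel)"
    using nn_integral_gauge_weight[OF cD] by simp
  also have "\<dots> = (\<integral>\<^sup>+x. ennreal v * gauge_weight D x \<partial>lborel)"
    using gauge_weight_measurable[OF cD] by (simp add: nn_integral_cmult)
  also have "\<dots> \<le> (\<integral>\<^sup>+x. emeasure lborel (K \<inter> (+) x ` K) \<partial>lborel)"
    by (intro nn_integral_mono le)
  also have "\<dots> = ennreal v * ennreal v"
    using nn_integral_covariogram[of K] K eK by (simp add: compact_imp_closed)
  finally have *: "ennreal v * (ennreal (1 / ?C) * emeasure lborel D) \<le> ennreal v * ennreal v" .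
  have "emeasure lborel D = ennreal (measure lborel D)"
    using cD by (intro emeasure_eq_measure2 fmeasurable_compact)
  then have "v * (1 / ?C * measure lborel D) \<le> v * v"
    using * v by (simp add: ennreal_mult[symmetric])
  then have "measure lborel D \<le> ?C * v" using v C by (simp add: field_simps)
  then show ?thesis
    using \<open>emeasure lborel D = ennreal (measure lborel D)\<close> eK v unfolding D_def[symmetric]
    by (simp add: ennreal_mult[symmetric])
qed

text \<open>If the intersection with a translate is never larger than a homothetic copy of the size that the
  gauge of the difference body allows, the estimate of the covariogram is sharp and the same
  integration gives the opposite inequality.\<close>
lemma rogers_shephard_converse:
  fixes K :: "'a::euclidean_space set"
  assumes K: "compact K" "convex K"
    and homothetic: "\<And>x. K \<inter> (+) x ` K \<noteq> {} \<Longrightarrow>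
      \<exists>l\<in>{0..1}. x \<in> (*\<^sub>R) l ` (K + uminus ` K) \<and> (\<exists>z. K \<inter> (+) x ` K \<subseteq> (\<lambda>k. z + (1 - l) *\<^sub>R k) ` K)"
  shows "ennreal (real ((2 * DIM('a)) choose DIM('a))) * emeasure lborel K \<le> emeasure lborel (K + uminus ` K)"
proof (cases "emeasure lborel K = 0")
  case True
  then show ?thesis by simp
next
  case False
  define D where "D = K + uminus ` K"
  define v where "v = measure lborel K"
  have cD: "compact D" unfolding D_def using K by (intro compact_set_plus compact_negations)
  have eK: "emeasure lborel K = ennreal v"
    unfolding v_def using K by (intro emeasure_eq_measure2 fmeasurable_compact)
  then have v: "0 < v" using False v_def measure_nonneg[of lborel K] by (metis ennreal_0 less_eq_real_def)
  let ?N = "DIM('a)" let ?C = "real ((2 * DIM('a)) choose DIM('a))"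
  have C: "0 < ?C" by simp
  have "K \<noteq> {}" using False by auto
  then have D0: "0 \<in> D" unfolding D_def by (force simp: set_plus_def)
  have "convex D" unfolding D_def using K by (intro convex_set_plus convex_negations)
  have le: "emeasure lborel (K \<inter> (+) x ` K) \<le> ennreal v * gauge_weight D x" for x
  proof (cases "K \<inter> (+) x ` K = {}")
    case False
    then obtain l z where l: "l \<in> {0..1}" and x: "x \<in> (*\<^sub>R) l ` D"
      and z: "K \<inter> (+) x ` K \<subseteq> (\<lambda>k. z + (1 - l) *\<^sub>R k) ` K"
      using homothetic unfolding D_def by blast
    \<comment> \<open>The multiples of \<open>D\<close> increase with the factor, because \<open>D\<close> is convex and contains 0.\<close>
    have xm: "x \<in> (*\<^sub>R) m ` D" if m: "l \<le> m" for m
    proof (cases "m = 0")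
      case True
      then show ?thesis using l m x by (simp add: order_antisym)
    next
      case False
      obtain d where d: "d \<in> D" "x = l *\<^sub>R d" using x by blast
      have "(l / m) *\<^sub>R d \<in> D"
        using convexD_alt[OF \<open>convex D\<close> D0 d(1), of "l / m"] l m False by (simp add: divide_le_eq_1)
      moreover have "x = m *\<^sub>R ((l / m) *\<^sub>R d)" using d False by simp
      ultimately show ?thesis by blast
    qed
    have bK: "K \<in> sets borel" using K by (simp add: borel_compact)
    have "compact ((\<lambda>k. z + (1 - l) *\<^sub>R k) ` K)"
      using K by (intro compact_continuous_image continuous_intros)
    then have "emeasure lborel (K \<inter> (+) x ` K) \<le> emeasure lborel ((\<lambda>k. z + (1 - l) *\<^sub>R k) ` K)"
      by (intro emeasure_mono[OF z]) (simp add: borel_compact)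
    also have "\<dots> = ennreal v * ennreal ((1 - l) ^ ?N)"
      using emeasure_affine_image[OF bK, of z "1 - l"] l eK by (simp add: mult.commute)
    also have "ennreal ((1 - l) ^ ?N)
        = (\<integral>\<^sup>+m. ennreal (real ?N * (1 - m) ^ (?N - 1)) * indicator {l..1} m \<partial>lborel)"
      using l by (intro nn_integral_radial_weight[symmetric]) auto
    also have "\<dots> \<le> gauge_weight D x"
      unfolding gauge_weight_def
      using xm l by (intro nn_integral_mono mult_left_mono) (auto simp: indicator_def)
    finally show ?thesis by (simp add: mult_left_mono)
  qed simp
  have "ennreal v * ennreal v = (\<integral>\<^sup>+x. emeasure lborel (K \<inter> (+) x ` K) \<partial>lborel)"
    using nn_integral_covariogram[of K] K eK by (simp add: compact_imp_closed)
  also have "\<dots> \<le> (\<integral>\<^sup>+x. ennreal v * gauge_weight D x \<partial>lborel)"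
    by (intro nn_integral_mono le)
  also have "\<dots> = ennreal v * (ennreal (1 / ?C) * emeasure lborel D)"
    using gauge_weight_measurable[OF cD] nn_integral_gauge_weight[OF cD] by (simp add: nn_integral_cmult)
  finally have *: "ennreal v * ennreal v \<le> ennreal v * (ennreal (1 / ?C) * emeasure lborel D)" .
  have eD: "emeasure lborel D = ennreal (measure lborel D)"
    using cD by (intro emeasure_eq_measure2 fmeasurable_compact)
  then have "v * v \<le> v * (1 / ?C * measure lborel D)"
    using * v by (simp add: ennreal_mult[symmetric])
  then have "?C * v \<le> measure lborel D" using v C by (simp add: field_simps)
  then show ?thesis
    using eD eK v unfolding D_def[symmetric] by (simp add: ennreal_mult[symmetric])
qed

text \<open>A simplex with a vertex at 0 is described in the basis of its edges at 0 by nonnegative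
  coordinates of sum at most 1. The intersection with the translate by \<open>x\<close> is described by lower
  bounds \<open>max 0 (r x b)\<close> for the coordinates and an upper bound \<open>m\<close> for their sum. It is the simplex
  with corner \<open>z\<close>, the point whose coordinates are the lower bounds, scaled by the gap \<open>m - s\<close>
  between the upper bound and the sum of the lower bounds. The points \<open>z\<close> and \<open>z - x\<close> lie in the
  simplex scaled by \<open>1 - (m - s)\<close>, which exhibits \<open>x\<close> as an element of the scaled difference body.\<close>
lemma corner_simplex_Int_translate:
  fixes B :: "'a::euclidean_space set"
  assumes B: "independent B" "span B = UNIV"
  defines "T \<equiv> {x. (\<forall>b\<in>B. 0 \<le> representation B x b) \<and> (\<Sum>b\<in>B. representation B x b) \<le> 1}"
  assumes ne: "T \<inter> (+) x ` T \<noteq> {}"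
  shows "\<exists>l\<in>{0..1}. x \<in> (*\<^sub>R) l ` (T + uminus ` T) \<and> (\<exists>z. T \<inter> (+) x ` T \<subseteq> (\<lambda>k. z + (1 - l) *\<^sub>R k) ` T)"
proof -
  define r where "r y b = representation B y b" for y b
  have fin: "finite B" using B(1) independent_imp_finite by blast
  have r_add: "r (y + y') b = r y b + r y' b" and r_diff: "r (y - y') b = r y b - r y' b"
    and r_scale: "r (c *\<^sub>R y) b = c * r y b" for y y' b c
    unfolding r_def using B by (simp_all add: representation_add representation_diff representation_scale)
  have r_sum: "r (\<Sum>b\<in>B. f b *\<^sub>R b) b = f b" if "b \<in> B" for f :: "'a \<Rightarrow> real" and b
  proof -
    have "r (\<Sum>b\<in>B. f b *\<^sub>R b) b = (\<Sum>b'\<in>B. f b' * r b' b)"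
      unfolding r_def using B by (simp add: representation_sum representation_scale)
    also have "\<dots> = (\<Sum>b'\<in>B. if b' = b then f b' else 0)"
      using B(1) by (intro sum.cong) (auto simp: r_def representation_basis)
    finally show ?thesis using that fin by simp
  qed
  have r_eq0: "y = 0" if "\<And>b. b \<in> B \<Longrightarrow> r y b = 0" for y
    using sum_representation_eq[OF B(1), of y B] B(2) fin that by (simp add: r_def)
  have T: "T = {y. (\<forall>b\<in>B. 0 \<le> r y b) \<and> (\<Sum>b\<in>B. r y b) \<le> 1}"
    by (simp add: T_def r_def)
  have scaled: "y \<in> (*\<^sub>R) c ` T" if c: "0 \<le> c" and y: "\<And>b. b \<in> B \<Longrightarrow> 0 \<le> r y b" "(\<Sum>b\<in>B. r y b) \<le> c" for c y
  proof (cases "c = 0")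
    case True
    then have "(\<Sum>b\<in>B. r y b) = 0" using y by (intro order_antisym sum_nonneg) auto
    then have "y = 0" using y fin by (intro r_eq0) (simp add: sum_nonneg_eq_0_iff)
    moreover have "T \<noteq> {}" using ne by auto
    ultimately show ?thesis using True by auto
  next
    case False
    then have "(1 / c) *\<^sub>R y \<in> T"
      using c y by (simp add: T r_scale sum_divide_distrib[symmetric] divide_le_eq_1)
    moreover have "y = c *\<^sub>R ((1 / c) *\<^sub>R y)" using False by simp
    ultimately show ?thesis by blast
  qed
  define s where "s = (\<Sum>b\<in>B. max 0 (r x b))"
  define m where "m = min 1 (1 + (\<Sum>b\<in>B. r x b))"
  define z where "z = (\<Sum>b\<in>B. max 0 (r x b) *\<^sub>R b)"
  define l where "l = 1 - (m - s)"
  have rz: "r z b = max 0 (r x b)" if "b \<in> B" for b unfolding z_def by (rule r_sum[OF that])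
  have sz: "(\<Sum>b\<in>B. r z b) = s" unfolding s_def by (intro sum.cong) (auto simp: rz)
  \<comment> \<open>The intersection is cut out by the same inequalities with the larger lower bounds.\<close>
  have Int: "(\<forall>b\<in>B. r z b \<le> r y b) \<and> (\<Sum>b\<in>B. r y b) \<le> m" if y: "y \<in> T \<inter> (+) x ` T" for y
  proof -
    have "y \<in> T" "y - x \<in> T" using y by auto
    then show ?thesis by (auto simp: T r_diff rz m_def sum_subtractf)
  qed
  have sm: "s \<le> m"
  proof -
    obtain y where "y \<in> T \<inter> (+) x ` T" using ne by blast
    then have "(\<Sum>b\<in>B. r z b) \<le> (\<Sum>b\<in>B. r y b)" "(\<Sum>b\<in>B. r y b) \<le> m" using Int by (auto intro: sum_mono)
    then show ?thesis using sz by simp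
  qed
  have "0 \<le> s" unfolding s_def by (intro sum_nonneg) auto
  have l: "l \<in> {0..1}" using sm \<open>0 \<le> s\<close> by (auto simp: l_def m_def)
  have "z \<in> (*\<^sub>R) l ` T"
  proof (rule scaled)
    show "(\<Sum>b\<in>B. r z b) \<le> l" unfolding sz by (simp add: l_def m_def)
  qed (use l in \<open>simp_all add: rz\<close>)
  moreover have "z - x \<in> (*\<^sub>R) l ` T"
  proof (rule scaled)
    have "(\<Sum>b\<in>B. r (z - x) b) = s - (\<Sum>b\<in>B. r x b)"
      unfolding sz[symmetric] by (simp only: r_diff sum_subtractf)
    then show "(\<Sum>b\<in>B. r (z - x) b) \<le> l" by (simp add: l_def m_def)
  qed (use l in \<open>simp_all add: r_diff rz\<close>)
  ultimately obtain p q where pq: "p \<in> T" "q \<in> T" "z = l *\<^sub>R p" "z - x = l *\<^sub>R q" by blast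
  then have "x = l *\<^sub>R (p + - q)" by (simp add: algebra_simps)
  moreover have "p + - q \<in> T + uminus ` T" using pq by blast
  ultimately have x: "x \<in> (*\<^sub>R) l ` (T + uminus ` T)" by blast
  have "T \<inter> (+) x ` T \<subseteq> (\<lambda>k. z + (1 - l) *\<^sub>R k) ` T"
  proof
    fix y assume y: "y \<in> T \<inter> (+) x ` T"
    have "y - z \<in> (*\<^sub>R) (1 - l) ` T"
    proof (rule scaled)
      have "(\<Sum>b\<in>B. r (y - z) b) = (\<Sum>b\<in>B. r y b) - s"
        unfolding sz[symmetric] by (simp only: r_diff sum_subtractf)
      then show "(\<Sum>b\<in>B. r (y - z) b) \<le> 1 - l" using Int[OF y] by (simp add: l_def)
    qed (use Int[OF y] sm in \<open>simp_all add: r_diff l_def\<close>)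
    then obtain k where "k \<in> T" "y - z = (1 - l) *\<^sub>R k" by blast
    then show "y \<in> (\<lambda>k. z + (1 - l) *\<^sub>R k) ` T" by (intro image_eqI[of _ _ k]) (simp_all add: algebra_simps)
  qed
  then show ?thesis using l x by blast
qed

text \<open>A nonempty interior forces full dimension, so the edges at a vertex form a basis, in which the
  coordinates of a point are the barycentric ones with that vertex left out.\<close>
lemma simplex_translate_corner:
  fixes S :: "'a::euclidean_space set"
  assumes "k simplex S" and "interior S \<noteq> {}"
  obtains a B where "independent B" "span B = UNIV"
    "S = (+) a ` {x. (\<forall>b\<in>B. 0 \<le> representation B x b) \<and> (\<Sum>b\<in>B. representation B x b) \<le> 1}"
proof -
  obtain V where V: "\<not> affine_dependent V" "S = convex hull V"
    using assms(1) by (auto simp: simplex_def)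
  have fin: "finite V" using V(1) by (rule aff_independent_finite)
  have "aff_dim V = int DIM('a)"
    using aff_dim_nonempty_interior[OF assms(2)] V(2) by (simp add: aff_dim_convex_hull)
  then have card: "card V = DIM('a) + 1" using aff_dim_affine_independent[OF V(1)] by simp
  then obtain a where a: "a \<in> V" by (metis card.empty add_is_0 ex_in_conv one_neq_zero)
  define B where "B = (\<lambda>x. - a + x) ` (V - {a})"
  have iB: "independent B" using affine_dependent_iff_dependent2[OF a] V(1) unfolding B_def by blast
  have "card B = DIM('a)" unfolding B_def using card a fin by (simp add: card_image inj_on_def)
  then have sB: "span B = UNIV"
    using card_ge_dim_independent[of B UNIV] iB by auto
  have finB: "finite B" using fin by (simp add: B_def)
  have rsum: "(\<Sum>b\<in>B. representation B x b *\<^sub>R b) = x" for x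
    using sum_representation_eq[OF iB, of x B] sB finB by simp
  have reindex: "(\<Sum>x\<in>V - {a}. h (- a + x)) = (\<Sum>b\<in>B. h b)" for h :: "'a \<Rightarrow> 'c::comm_monoid_add"
    unfolding B_def by (subst sum.reindex) (auto simp: inj_on_def)
  let ?T = "{x. (\<forall>b\<in>B. 0 \<le> representation B x b) \<and> (\<Sum>b\<in>B. representation B x b) \<le> 1}"
  have "S = (+) a ` ?T"
  proof (intro set_eqI iffI)
    fix y assume "y \<in> S"
    then obtain u where u: "\<forall>x\<in>V. 0 \<le> u x" "sum u V = 1" "(\<Sum>x\<in>V. u x *\<^sub>R x) = y"
      unfolding V(2) convex_hull_finite[OF fin] by blast
    have "y - a = (\<Sum>x\<in>V. u x *\<^sub>R x) - (\<Sum>x\<in>V. u x) *\<^sub>R a" using u by simp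
    also have "\<dots> = (\<Sum>x\<in>V. u x *\<^sub>R (- a + x))"
      by (simp add: scaleR_left.sum sum_subtractf[symmetric] algebra_simps)
    also have "\<dots> = (\<Sum>x\<in>V - {a}. u x *\<^sub>R (- a + x))"
      using a fin by (simp add: sum.remove)
    also have "\<dots> = (\<Sum>b\<in>B. u (a + b) *\<^sub>R b)"
      using reindex[of "\<lambda>b. u (a + b) *\<^sub>R b"] by simp
    finally have ya: "y - a = (\<Sum>b\<in>B. u (a + b) *\<^sub>R b)" .
    have rep: "representation B (y - a) b = u (a + b)" if "b \<in> B" for b
    proof -
      have "representation B (y - a) b = (\<Sum>b'\<in>B. u (a + b') * representation B b' b)"
        unfolding ya using iB sB by (simp add: representation_sum representation_scale)
      also have "\<dots> = (\<Sum>b'\<in>B. if b' = b then u (a + b') else 0)"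
        using iB by (intro sum.cong) (auto simp: representation_basis)
      finally show ?thesis using that finB by simp
    qed
    have "(\<Sum>b\<in>B. u (a + b)) = (\<Sum>x\<in>V - {a}. u x)" using reindex[of "\<lambda>b. u (a + b)"] by simp
    also have "\<dots> \<le> sum u V" using u a fin by (intro sum_mono2) auto
    also have "\<dots> = 1" by (rule u(2))
    finally have "y - a \<in> ?T" using rep u by (auto simp: B_def)
    then show "y \<in> (+) a ` ?T" by (intro image_eqI[of _ _ "y - a"]) simp_all
  next
    fix y assume "y \<in> (+) a ` ?T"
    then obtain t where t: "t \<in> ?T" "y = a + t" by blast
    define u where "u x = (if x = a then 1 - (\<Sum>b\<in>B. representation B t b) else representation B t (- a + x))" for x
    have s1: "(\<Sum>x\<in>V - {a}. u x) = (\<Sum>b\<in>B. representation B t b)"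
      using reindex[of "\<lambda>b. representation B t b"] by (simp add: u_def)
    have s2: "(\<Sum>x\<in>V - {a}. u x *\<^sub>R (- a + x)) = t"
      using reindex[of "\<lambda>b. representation B t b *\<^sub>R b"] rsum by (simp add: u_def)
    have "(\<Sum>x\<in>V. u x *\<^sub>R x) = u a *\<^sub>R a + (\<Sum>x\<in>V - {a}. u x *\<^sub>R (- a + x)) + (\<Sum>x\<in>V - {a}. u x) *\<^sub>R a"
    proof -
      have "(\<Sum>x\<in>V. u x *\<^sub>R x) = u a *\<^sub>R a + (\<Sum>x\<in>V - {a}. u x *\<^sub>R x)" by (rule sum.remove[OF fin a])
      also have "(\<Sum>x\<in>V - {a}. u x *\<^sub>R x) = (\<Sum>x\<in>V - {a}. u x *\<^sub>R (- a + x) + u x *\<^sub>R a)"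
        by (intro sum.cong) (simp_all add: scaleR_diff_right)
      finally show ?thesis by (simp only: sum.distrib scaleR_sum_left add.assoc)
    qed
    also have "\<dots> = (u a + (\<Sum>x\<in>V - {a}. u x)) *\<^sub>R a + t" unfolding s2 by (simp add: scaleR_left_distrib)
    finally have "(\<Sum>x\<in>V. u x *\<^sub>R x) = y" using s1 t by (simp add: u_def)
    moreover have "sum u V = 1" using s1 by (simp add: sum.remove[OF fin a] u_def)
    moreover have "\<forall>x\<in>V. 0 \<le> u x" using t by (auto simp: u_def B_def)
    ultimately show "y \<in> S" unfolding V(2) convex_hull_finite[OF fin] by blast
  qed
  then show thesis using that iB sB by blast
qed

text \<open>For a simplex of lower dimension both sides vanish. A full-dimensional one may be moved to have a
  vertex at 0, as translations change neither its volume nor its difference body.\<close>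
lemma rogers_shephard_simplex:
  fixes S :: "'a::euclidean_space set"
  assumes S: "k simplex S"
  shows "emeasure lborel (S + uminus ` S) = ennreal (real ((2 * DIM('a)) choose DIM('a))) * emeasure lborel S"
proof (rule antisym)
  have cS: "compact S" "convex S" using S by (rule compact_simplex, rule convex_simplex)
  show "emeasure lborel (S + uminus ` S) \<le> ennreal (real ((2 * DIM('a)) choose DIM('a))) * emeasure lborel S"
    by (rule rogers_shephard[OF cS])
  show "ennreal (real ((2 * DIM('a)) choose DIM('a))) * emeasure lborel S \<le> emeasure lborel (S + uminus ` S)"
  proof (cases "interior S = {}")
    case True
    then have "negligible S" using negligible_convex_interior[OF cS(2)] by simp
    then have "emeasure lborel S = 0"
      using cS by (simp add: negligible_iff_emeasure0 compact_imp_closed)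
    then show ?thesis by simp
  next
    case False
    obtain a B where B: "independent B" "span B = UNIV"
      and eq: "S = (+) a ` {x. (\<forall>b\<in>B. 0 \<le> representation B x b) \<and> (\<Sum>b\<in>B. representation B x b) \<le> 1}"
      by (rule simplex_translate_corner[OF S False])
    define T where "T = {x. (\<forall>b\<in>B. 0 \<le> representation B x b) \<and> (\<Sum>b\<in>B. representation B x b) \<le> 1}"
    have ST: "S = (+) a ` T" unfolding T_def by (rule eq)
    have TS: "T = (+) (- a) ` S" unfolding ST by (auto simp: image_image)
    have cT: "compact T" "convex T"
      unfolding TS by (rule compact_translation[OF cS(1)], rule convex_translation[OF cS(2)])
    have "ennreal (real ((2 * DIM('a)) choose DIM('a))) * emeasure lborel T \<le> emeasure lborel (T + uminus ` T)"
      using corner_simplex_Int_translate[OF B] unfolding T_def[symmetric]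
      by (intro rogers_shephard_converse cT)
    moreover have "emeasure lborel S = emeasure lborel T"
      using emeasure_affine_image[OF borel_compact[OF cT(1)], of a 1] unfolding ST by simp
    moreover have "S + uminus ` S = T + uminus ` T"
      unfolding ST
    proof (intro set_eqI iffI)
      fix y assume "y \<in> (+) a ` T + uminus ` (+) a ` T"
      then obtain p q where "p \<in> T" "q \<in> T" "y = (a + p) + - (a + q)" by (auto elim!: set_plus_elim)
      then have "y = p + - q" by simp
      then show "y \<in> T + uminus ` T" using \<open>p \<in> T\<close> \<open>q \<in> T\<close> by blast
    next
      fix y assume "y \<in> T + uminus ` T"
      then obtain p q where "p \<in> T" "q \<in> T" "y = p + - q" by (auto elim!: set_plus_elim)
      then have "y = (a + p) + - (a + q)" by simp
      then show "y \<in> (+) a ` T + uminus ` (+) a ` T" using \<open>p \<in> T\<close> \<open>q \<in> T\<close> by blast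
    qed
    ultimately show ?thesis by simp
  qed
qed

text \<open>The sets \<open>K + L\<close> and \<open>K - L\<close> have the same difference body; Brunn--Minkowski for the one and
  Rogers--Shephard for the other compare their volumes with that of this common body.\<close>
lemma emeasure_sum_le_difference:
  fixes K L :: "'a::euclidean_space set"
  assumes "compact K" "convex K" "compact L" "convex L"
  shows "emeasure lborel (K + L)
    \<le> ennreal (real ((2 * DIM('a)) choose DIM('a)) / 2 ^ DIM('a)) * emeasure lborel (K + uminus ` L)"
proof -
  let ?C = "real ((2 * DIM('a)) choose DIM('a))"
  define M where "M = K + L"
  define N where "N = K + uminus ` L"
  have M: "compact M" "convex M"
    unfolding M_def using assms by (auto intro: compact_set_plus convex_set_plus)
  have N: "compact N" "convex N"
    unfolding N_def using assms by (auto intro!: compact_set_plus convex_set_plus compact_negations convex_negations)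
  have eq: "M + uminus ` M = N + uminus ` N"
    unfolding M_def N_def uminus_image_plus by (simp add: image_image add_ac)
  have D: "compact (N + uminus ` N)" using N by (intro compact_set_plus compact_negations)
  have e: "emeasure lborel S = ennreal (measure lborel S)" if "compact S" for S :: "'a set"
    using that by (intro emeasure_eq_measure2 fmeasurable_compact)
  have "ennreal (measure lborel (N + uminus ` N)) \<le> ennreal (?C * measure lborel N)"
    using rogers_shephard[OF N] by (simp add: e N D ennreal_mult)
  then have "measure lborel (N + uminus ` N) \<le> ?C * measure lborel N"
    by (subst (asm) ennreal_le_iff) auto
  then have "2 ^ DIM('a) * measure lborel M \<le> ?C * measure lborel N"
    using brunn_minkowski_difference[OF M] eq by simp
  then have "measure lborel M \<le> ?C / 2 ^ DIM('a) * measure lborel N"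
    by (simp add: field_simps)
  then have "ennreal (measure lborel M) \<le> ennreal (?C / 2 ^ DIM('a) * measure lborel N)"
    by (rule ennreal_leI)
  then have "emeasure lborel M \<le> ennreal (?C / 2 ^ DIM('a)) * emeasure lborel N"
    unfolding e[OF M(1)] e[OF N(1)] by (subst ennreal_mult[symmetric]) auto
  then show ?thesis by (simp only: M_def N_def)
qed

section \<open>Superlevel sets of the quasi-sum\<close>

lemma C_minus_infinity_le_1:
  assumes "f \<in> C_minus_infinity" shows "f x \<le> 1"
proof -
  have "ennreal \<bar>f x\<bar> \<le> norm_sup f" unfolding norm_sup_def by (rule SUP_upper) simp
  then show ?thesis using assms by (simp add: C_minus_infinity_def)
qed

lemma compact_superlevel:
  fixes f :: "'a::euclidean_space \<Rightarrow> real"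
  assumes f: "f \<in> C_minus_infinity" and t: "0 < t"
  shows "compact (superlevel f t)"
proof -
  have "open {x. f x < t}"
  proof (subst open_subopen, rule ballI)
    fix x assume "x \<in> {x. f x < t}"
    then have fx: "f x < t" by simp
    moreover have "upper_semicontinuous f" using f by (simp add: C_minus_infinity_def)
    ultimately have "\<forall>\<^sub>F y in at x. f y < t" unfolding upper_semicontinuous_def by blast
    then obtain U where "open U" "x \<in> U" "\<forall>y\<in>U. y \<noteq> x \<longrightarrow> f y < t"
      by (auto simp: eventually_at_topological)
    then show "\<exists>T. open T \<and> x \<in> T \<and> T \<subseteq> {x. f x < t}" using fx by (intro exI[of _ U]) auto
  qed
  moreover have "superlevel f t = - {x. f x < t}" by (auto simp: superlevel_def)
  ultimately have "closed (superlevel f t)" by (simp only: closed_Compl)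
  moreover have "bounded (superlevel f t)"
  proof -
    have "(f \<longlongrightarrow> 0) at_infinity" using f by (simp add: C_minus_infinity_def)
    then have "\<forall>\<^sub>F x in at_infinity. f x < t" using t by (rule order_tendstoD)
    then obtain b where b: "\<And>x. b \<le> norm x \<Longrightarrow> f x < t" by (auto simp: eventually_at_infinity)
    have "norm x \<le> b" if "x \<in> superlevel f t" for x
      using that b[of x] by (cases "norm x \<le> b") (auto simp: superlevel_def)
    then show ?thesis by (auto simp: bounded_iff)
  qed
  ultimately show ?thesis by (simp add: compact_eq_bounded_closed)
qed

lemma convex_superlevel:
  assumes "f \<in> C_minus_infinity"
  shows "convex (superlevel f t)"
proof (rule convexI)
  fix x y and u v :: real
  assume *: "x \<in> superlevel f t" "y \<in> superlevel f t" "0 \<le> u" "0 \<le> v" "u + v = 1"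
  then have "v = 1 - u" "u \<in> {0..1}" by auto
  then have "min (f x) (f y) \<le> f (u *\<^sub>R x + v *\<^sub>R y)"
    using assms by (auto simp: C_minus_infinity_def quasi_concave_def)
  then show "u *\<^sub>R x + v *\<^sub>R y \<in> superlevel f t" using * by (auto simp: superlevel_def)
qed

lemma superlevel_reflect:
  fixes g :: "'a::group_add \<Rightarrow> real"
  shows "superlevel (reflect g) t = uminus ` superlevel g t"
proof (intro set_eqI iffI)
  fix x assume "x \<in> superlevel (reflect g) t"
  then show "x \<in> uminus ` superlevel g t"
    by (intro image_eqI[of _ _ "- x"]) (simp_all add: superlevel_def reflect_def)
qed (auto simp: superlevel_def reflect_def)

lemma reflect_C_minus_infinity:
  fixes g :: "'a::euclidean_space \<Rightarrow> real"
  assumes g: "g \<in> C_minus_infinity"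
  shows "reflect g \<in> C_minus_infinity"
proof -
  have g0: "g 0 = 1" "\<And>x. 0 \<le> g x" using g by (auto simp: C_minus_infinity_def)
  have "upper_semicontinuous (reflect g)"
    unfolding upper_semicontinuous_def
  proof (intro allI impI)
    fix x c assume "reflect g x < c"
    moreover have "upper_semicontinuous g" using g by (simp add: C_minus_infinity_def)
    ultimately have "\<forall>\<^sub>F y in at (- x). g y < c"
      unfolding upper_semicontinuous_def reflect_def by blast
    then obtain d where d: "0 < d" "\<And>y. y \<noteq> - x \<Longrightarrow> dist y (- x) < d \<Longrightarrow> g y < c"
      by (auto simp: eventually_at)
    show "\<forall>\<^sub>F y in at x. reflect g y < c"
      unfolding eventually_at reflect_def using d by (intro exI[of _ d]) (auto simp: dist_minus)
  qed
  moreover have "quasi_concave (reflect g)"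
    unfolding quasi_concave_def
  proof (intro allI ballI)
    fix x y :: 'a and u :: real assume "u \<in> {0..1}"
    moreover have "quasi_concave g" using g by (simp add: C_minus_infinity_def)
    ultimately have "min (g (- x)) (g (- y)) \<le> g (u *\<^sub>R (- x) + (1 - u) *\<^sub>R (- y))"
      unfolding quasi_concave_def by blast
    also have "u *\<^sub>R (- x) + (1 - u) *\<^sub>R (- y) = - (u *\<^sub>R x + (1 - u) *\<^sub>R y)" by simp
    finally show "min (reflect g x) (reflect g y) \<le> reflect g (u *\<^sub>R x + (1 - u) *\<^sub>R y)"
      by (simp only: reflect_def)
  qed
  moreover have "norm_sup (reflect g) = ennreal (reflect g 0)"
    unfolding norm_sup_def
  proof (rule antisym)
    show "(SUP x. ennreal \<bar>reflect g x\<bar>) \<le> ennreal (reflect g 0)"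
      using g0 C_minus_infinity_le_1[OF g] by (intro SUP_least) (simp add: reflect_def)
    show "ennreal (reflect g 0) \<le> (SUP x. ennreal \<bar>reflect g x\<bar>)"
      using g0 by (intro SUP_upper2[of 0]) (auto simp: reflect_def)
  qed
  moreover have "(reflect g \<longlongrightarrow> 0) at_infinity"
  proof (rule tendstoI)
    fix e :: real assume "0 < e"
    moreover have "(g \<longlongrightarrow> 0) at_infinity" using g by (simp add: C_minus_infinity_def)
    ultimately have "\<forall>\<^sub>F x in at_infinity. dist (g x) 0 < e" by (intro tendstoD)
    then obtain b where "\<And>x. b \<le> norm x \<Longrightarrow> dist (g x) 0 < e" by (auto simp: eventually_at_infinity)
    then show "\<forall>\<^sub>F x in at_infinity. dist (reflect g x) 0 < e"
      unfolding eventually_at_infinity reflect_def by (intro exI[of _ b]) simp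
  qed
  ultimately show ?thesis using g0 by (simp add: C_minus_infinity_def reflect_def)
qed

lemma quasi_sum_eq: "quasi_sum f g x = (SUP y. min (f y) (g (x - y)))"
proof -
  have "(\<lambda>(y, z). min (f y) (g z)) ` {(y, z). y + z = x} = range (\<lambda>y. min (f y) (g (x - y)))"
  proof (intro set_eqI iffI)
    fix v assume "v \<in> (\<lambda>(y, z). min (f y) (g z)) ` {(y, z). y + z = x}"
    then obtain y z where "v = min (f y) (g z)" "y + z = x" by auto
    then have "v = min (f y) (g (x - y))" by (auto simp: algebra_simps)
    then show "v \<in> range (\<lambda>y. min (f y) (g (x - y)))" by blast
  next
    fix v assume "v \<in> range (\<lambda>y. min (f y) (g (x - y)))"
    then obtain y where "v = min (f y) (g (x - y))" by blast
    then show "v \<in> (\<lambda>(y, z). min (f y) (g z)) ` {(y, z). y + z = x}"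
      by (intro image_eqI[of _ _ "(y, x - y)"]) auto
  qed
  then show ?thesis by (simp add: quasi_sum_def)
qed

lemma quasi_sum_bdd:
  assumes "f \<in> C_minus_infinity"
  shows "bdd_above (range (\<lambda>y. min (f y) (g (x - y))))"
  by (rule bdd_aboveI2[of _ _ 1], rule min.coboundedI1, rule C_minus_infinity_le_1[OF assms])

lemma quasi_sum_bounds:
  assumes f: "f \<in> C_minus_infinity" and g: "g \<in> C_minus_infinity"
  shows "0 \<le> quasi_sum f g x" "quasi_sum f g x \<le> 1"
proof -
  have "0 \<le> min (f 0) (g (x - 0))" using f g by (auto simp: C_minus_infinity_def)
  also have "\<dots> \<le> quasi_sum f g x"
    unfolding quasi_sum_eq by (rule cSUP_upper[OF _ quasi_sum_bdd[OF f]]) simp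
  finally show "0 \<le> quasi_sum f g x" .
  show "quasi_sum f g x \<le> 1"
    unfolding quasi_sum_eq by (intro cSUP_least min.coboundedI1 C_minus_infinity_le_1[OF f]) simp
qed

text \<open>The inclusion from left to right says that the supremum is attained when it is positive: the
  points \<open>y\<close> with \<open>s \<le> f y\<close> and \<open>s \<le> g (x - y)\<close> form a compact set, nonempty for \<open>s < t\<close>, and these
  sets are nested, so they have a common point as \<open>s\<close> increases to \<open>t\<close>.\<close>
lemma superlevel_quasi_sum:
  fixes f g :: "'a::euclidean_space \<Rightarrow> real"
  assumes f: "f \<in> C_minus_infinity" and g: "g \<in> C_minus_infinity" and t: "0 < t"
  shows "superlevel (quasi_sum f g) t = superlevel f t + superlevel g t"
proof (intro set_eqI iffI)
  fix x assume "x \<in> superlevel f t + superlevel g t"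
  then obtain y z where yz: "t \<le> f y" "t \<le> g z" "x = y + z"
    by (auto simp: superlevel_def elim: set_plus_elim)
  then have "t \<le> min (f y) (g (x - y))" by simp
  also have "\<dots> \<le> quasi_sum f g x"
    unfolding quasi_sum_eq by (rule cSUP_upper[OF _ quasi_sum_bdd[OF f]]) simp
  finally show "x \<in> superlevel (quasi_sum f g) t" by (simp add: superlevel_def)
next
  fix x assume x: "x \<in> superlevel (quasi_sum f g) t"
  define s where "s k = t - t * inverse (real (Suc (Suc k)))" for k :: nat
  have s: "0 < s k" "s k < t" for k
    using mult_strict_left_mono[OF _ t, of "inverse (real (Suc (Suc k)))" 1] t
    by (auto simp: s_def inverse_less_1_iff)
  have s_mono: "s m \<le> s k" if "m \<le> k" for m k
    using that t unfolding s_def by (intro diff_left_mono mult_left_mono le_imp_inverse_le) auto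
  define F where "F k = superlevel f (s k) \<inter> (\<lambda>z. x + (- z)) ` superlevel g (s k)" for k
  have F_iff: "y \<in> F k \<longleftrightarrow> s k \<le> f y \<and> s k \<le> g (x - y)" for y k
    by (auto simp: F_def superlevel_def intro!: image_eqI[of _ _ "x - y"])
  have "\<Inter> (range F) \<noteq> {}"
  proof (rule compact_nest)
    show "compact (F k)" for k
      unfolding F_def using compact_superlevel[OF f s(1)] compact_superlevel[OF g s(1)]
      by (intro compact_Int compact_continuous_image continuous_intros)
    show "F k \<noteq> {}" for k
    proof -
      have "s k < quasi_sum f g x" using x s(2)[of k] by (simp add: superlevel_def)
      then obtain y where "s k < min (f y) (g (x - y))"
        unfolding quasi_sum_eq by (subst (asm) less_cSUP_iff) (use quasi_sum_bdd[OF f] in auto)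
      then have "y \<in> F k" by (simp add: F_iff)
      then show ?thesis by blast
    qed
    show "F k \<subseteq> F m" if "m \<le> k" for m k
      using s_mono[OF that] by (auto simp: F_iff)
  qed
  then obtain y where "y \<in> \<Inter> (range F)" by blast
  then have y: "s k \<le> f y" "s k \<le> g (x - y)" for k by (auto simp: F_iff)
  have "s \<longlonglongrightarrow> t - t * 0"
    unfolding s_def by (intro tendsto_intros LIMSEQ_Suc[OF LIMSEQ_inverse_real_of_nat])
  then have lim: "s \<longlonglongrightarrow> t" by simp
  have "t \<le> f y" "t \<le> g (x - y)" using y by (auto intro: LIMSEQ_le_const2[OF lim])
  then show "x \<in> superlevel f t + superlevel g t"
    using set_plus_intro[of y "superlevel f t" "x - y"] by (simp add: superlevel_def)
qed

text \<open>Fubini for the region under the graph. Levels above 1 contribute nothing, and the measurability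
  in the level is recorded for later use of linearity.\<close>
lemma norm_L1_layer_cake:
  fixes h :: "'a::euclidean_space \<Rightarrow> real"
  assumes bounds: "\<And>x. 0 \<le> h x" "\<And>x. h x \<le> 1" and level: "\<And>t. 0 < t \<Longrightarrow> superlevel h t \<in> sets borel"
  shows "norm_L1 h = (\<integral>\<^sup>+t. indicator {0<..1} t * emeasure lborel (superlevel h t) \<partial>lborel)"
    and "(\<lambda>t. indicator {0<..1} t * emeasure lborel (superlevel h t)) \<in> borel_measurable borel"
proof -
  have h [measurable]: "h \<in> borel_measurable borel"
    unfolding borel_measurable_iff_ge
  proof
    fix a
    show "{w \<in> space borel. a \<le> h w} \<in> sets borel"
    proof (cases "0 < a")
      case True
      then show ?thesis using level[of a] by (simp add: superlevel_def)
    next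
      case False
      then have "a \<le> h w" for w using bounds(1)[of w] by simp
      then show ?thesis by simp
    qed
  qed
  define E where "E = {(x, t). 0 < t \<and> t \<le> h x}"
  have "E = {p \<in> space (borel \<Otimes>\<^sub>M borel). 0 < snd p \<and> snd p \<le> h (fst p)}"
    by (auto simp: E_def space_pair_measure)
  also have "\<dots> \<in> sets (borel \<Otimes>\<^sub>M borel)" by measurable
  finally have E [measurable]: "E \<in> sets (borel \<Otimes>\<^sub>M borel)" .
  have sec: "(\<integral>\<^sup>+x. indicator E (x, t) \<partial>lborel) = indicator {0<..1} t * emeasure lborel (superlevel h t)" for t
  proof (cases "t \<in> {0<..1}")
    case True
    have "(\<integral>\<^sup>+x. indicator E (x, t) \<partial>lborel) = (\<integral>\<^sup>+x. indicator (superlevel h t) x \<partial>lborel)"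
      using True by (intro nn_integral_cong) (auto simp: E_def superlevel_def indicator_def)
    then show ?thesis using True level[of t] by simp
  next
    case False
    have "indicator E (x, t) = (0 :: ennreal)" for x
      using False bounds(2)[of x] by (auto simp: E_def indicator_def)
    then show ?thesis using False by simp
  qed
  have "norm_L1 h = (\<integral>\<^sup>+x. \<integral>\<^sup>+t. indicator E (x, t) \<partial>lborel \<partial>lborel)"
    unfolding norm_L1_def
  proof (intro nn_integral_cong)
    fix x
    have "(\<integral>\<^sup>+t. indicator E (x, t) \<partial>lborel) = (\<integral>\<^sup>+t. indicator {0<..h x} t \<partial>lborel)"
      by (intro nn_integral_cong) (auto simp: E_def indicator_def)
    then show "ennreal (h x) = (\<integral>\<^sup>+t. indicator E (x, t) \<partial>lborel)" using bounds(1) by simp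
  qed
  also have "\<dots> = (\<integral>\<^sup>+t. \<integral>\<^sup>+x. indicator E (x, t) \<partial>lborel \<partial>lborel)"
    by (rule lborel_pair.Fubini'[symmetric]) measurable
  finally show "norm_L1 h = (\<integral>\<^sup>+t. indicator {0<..1} t * emeasure lborel (superlevel h t) \<partial>lborel)"
    by (simp add: sec)
  have "(\<lambda>t. \<integral>\<^sup>+x. indicator E (x, t) \<partial>lborel) \<in> borel_measurable borel" by measurable
  then show "(\<lambda>t. indicator {0<..1} t * emeasure lborel (superlevel h t)) \<in> borel_measurable borel"
    by (simp add: sec)
qed

lemma norm_L1_quasi_sum:
  fixes f g :: "'a::euclidean_space \<Rightarrow> real"
  assumes f: "f \<in> C_minus_infinity" and g: "g \<in> C_minus_infinity"
  shows "norm_L1 (quasi_sum f g)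
      = (\<integral>\<^sup>+t. indicator {0<..1} t * emeasure lborel (superlevel f t + superlevel g t) \<partial>lborel)"
    and "(\<lambda>t. indicator {0<..1} t * emeasure lborel (superlevel f t + superlevel g t)) \<in> borel_measurable borel"
proof -
  have level: "superlevel (quasi_sum f g) t \<in> sets borel" if "0 < t" for t
    using that compact_superlevel[OF f that] compact_superlevel[OF g that]
    by (simp add: superlevel_quasi_sum[OF f g] borel_compact compact_set_plus)
  have eq: "indicator {0<..1} t * emeasure lborel (superlevel (quasi_sum f g) t)
      = indicator {0<..1} t * emeasure lborel (superlevel f t + superlevel g t)" for t
    by (auto simp: indicator_def superlevel_quasi_sum[OF f g])
  note cake = norm_L1_layer_cake[OF quasi_sum_bounds[OF f g] level, unfolded eq]
  show "norm_L1 (quasi_sum f g)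
      = (\<integral>\<^sup>+t. indicator {0<..1} t * emeasure lborel (superlevel f t + superlevel g t) \<partial>lborel)"
    by (rule cake(1))
  show "(\<lambda>t. indicator {0<..1} t * emeasure lborel (superlevel f t + superlevel g t)) \<in> borel_measurable borel"
    by (rule cake(2))
qed

theorem proposition1p5:
  fixes f g :: "real ^ 'n \<Rightarrow> real"
  assumes "f \<in> C_minus_infinity" and "g \<in> C_minus_infinity"
    and "integrable lborel f" and "integrable lborel g"
  shows "norm_L1 (quasi_sum f g)
           \<le> ennreal (real ((2 * CARD('n)) choose CARD('n)) / 2 ^ CARD('n))
               * norm_L1 (quasi_sum f (reflect g))
         \<and> (f = reflect g \<longrightarrow>
            (AE t in lborel. t \<in> {0<..<1} \<longrightarrow> is_simplex (superlevel f t)) \<longrightarrow>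
            norm_L1 (quasi_sum f g)
              = ennreal (real ((2 * CARD('n)) choose CARD('n)) / 2 ^ CARD('n))
                  * norm_L1 (quasi_sum f (reflect g)))"
proof -
  note f = assms(1) and g = assms(2)
  define c where "c = ennreal (real ((2 * CARD('n)) choose CARD('n)) / 2 ^ CARD('n))"
  note g' = reflect_C_minus_infinity[OF g]
  have rhs: "c * norm_L1 (quasi_sum f (reflect g))
      = (\<integral>\<^sup>+t. c * (indicator {0<..1} t * emeasure lborel (superlevel f t + superlevel (reflect g) t)) \<partial>lborel)"
    using norm_L1_quasi_sum[OF f g'] by (simp add: nn_integral_cmult)
  have "norm_L1 (quasi_sum f g) \<le> c * norm_L1 (quasi_sum f (reflect g))"
    unfolding rhs norm_L1_quasi_sum(1)[OF f g]
  proof (rule nn_integral_mono)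
    fix t
    show "indicator {0<..1} t * emeasure lborel (superlevel f t + superlevel g t)
      \<le> c * (indicator {0<..1} t * emeasure lborel (superlevel f t + superlevel (reflect g) t))"
    proof (cases "t \<in> {0<..1}")
      case True
      then show ?thesis
        using emeasure_sum_le_difference[of "superlevel f t" "superlevel g t"]
        by (simp add: compact_superlevel f g convex_superlevel superlevel_reflect c_def)
    qed simp
  qed
  moreover have "norm_L1 (quasi_sum f g) = c * norm_L1 (quasi_sum f (reflect g))"
    if fg: "f = reflect g" and simplex: "AE t in lborel. t \<in> {0<..<1} \<longrightarrow> is_simplex (superlevel f t)"
    unfolding rhs norm_L1_quasi_sum(1)[OF f g]
  proof (rule nn_integral_cong_AE)
    have gf: "superlevel g t = uminus ` superlevel f t" for t
      unfolding fg superlevel_reflect by (simp add: image_image)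
    \<comment> \<open>The integrals include the level 1, about which the hypothesis says nothing.\<close>
    have "AE t in lborel. t \<noteq> (1::real)" by (rule AE_lborel_singleton)
    with simplex show "AE t in lborel. indicator {0<..1} t * emeasure lborel (superlevel f t + superlevel g t)
      = c * (indicator {0<..1} t * emeasure lborel (superlevel f t + superlevel (reflect g) t))"
    proof eventually_elim
      case (elim t)
      show ?case
      proof (cases "t \<in> {0<..1}")
        case True
        define S where "S = superlevel f t"
        obtain k where k: "k simplex S"
          using elim True unfolding is_simplex_def S_def by force
        have "emeasure lborel (S + uminus ` S) = ennreal (real ((2 * CARD('n)) choose CARD('n))) * emeasure lborel S"
          using rogers_shephard_simplex[OF k] by simp
        also have "\<dots> = c * emeasure lborel (S + S)"
        proof -
          have "c * ennreal (2 ^ CARD('n)) = ennreal (real ((2 * CARD('n)) choose CARD('n)))"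
            unfolding c_def by (simp add: ennreal_mult[symmetric])
          then show ?thesis
            using emeasure_convex_double[OF compact_simplex[OF k] convex_simplex[OF k]]
            by (simp add: mult.assoc[symmetric])
        qed
        finally show ?thesis using True unfolding gf fg[symmetric] S_def by simp
      qed simp
    qed
  qed
  ultimately show ?thesis unfolding c_def by blast
qed

end
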